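(* Consider the control system $\dot x(t) = f(x(t)) + g(x(t))u(x(t))$, $x(0)=x_0$, $t\ge 0$, in closed loop with the feedback $u:\mathbb{R}^n\to\mathbb{R}^m$ given by $$u(x) = \begin{cases} [1-\sigma(\gamma(x))]\,u_{\mathrm b}(x) + \sigma(\gamma(x))\,u_*(x), & x\in\Gamma,\\ u_{\mathrm b}(x), & x\notin \Gamma,\end{cases}$$ where all objects are as defined in the context. In particular, $\mathcal U=\{u\in\mathbb{R}^m: A_u u\le b_u\}$ is bounded and nonempty, and $u_{\mathrm b}:\mathbb{R}^n\to\mathcal U$ is continuously differentiable and makes $\mathcal S_{\mathrm b}$ forward invariant. Then the following hold: (a) $u$ is continuous on $\mathbb{R}^n$. (b) For all $x\in\mathbb{R}^n$, $u(x)\in\mathcal U$. (c) Assume $x(t)\in \mathrm{bd}\,\bar{\mathcal S}_*$, where $x(\cdot)$ is the closed-loop solution and $\mathrm{bd}$ denotes the boundary. Then there exists $\tau\in(0,T_{\mathrm s}]$ such that $x(t+\tau)\in\bar{\mathcal S}_*\subseteq \mathcal S_{\mathrm s}$. (d) Assume $x_0\in\mathcal S_*$, and let $\epsilon\ge \tfrac12 T_{\mathrm s}\, l_\phi\, l_{\mathrm s}$. Then for all $t\ge0$, $x(t)\in\mathcal S_*\subseteq\mathcal S_{\mathrm s}$.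
   Context: System: $\dot x = f(x)+g(x)u$, with state $x(t)\in\mathbb{R}^n$ and control $u(t)\in\mathbb{R}^m$, and with $f:\mathbb{R}^n\to\mathbb{R}^n$ and $g:\mathbb{R}^n\to\mathbb{R}^{n\times m}$ continuously differentiable. Admissible controls: $\mathcal U=\{u\in\mathbb{R}^m: A_uu\le b_u\}$ (componentwise inequality), $A_u\in\mathbb{R}^{r\times m}$, $b_u\in\mathbb{R}^r$, bounded and nonempty. Safe and backup safe sets: $h_{\mathrm s},h_{\mathrm b}:\mathbb{R}^n\to\mathbb{R}$ are continuously differentiable, $\mathcal S_{\mathrm s}=\{x\in\mathbb{R}^n: h_{\mathrm s}(x)\ge0\}$, $\mathcal S_{\mathrm b}=\{x\in\mathbb{R}^n: h_{\mathrm b}(x)\ge0\}$, and $\mathcal S_{\mathrm b}\subseteq\mathcal S_{\mathrm s}$. Backup control: $u_{\mathrm b}:\mathbb{R}^n\to\mathcal U$ is continuously differentiable. Assumption: if $u=u_{\mathrm b}$ and $x_0\in\mathcal S_{\mathrm b}$, then $x(t)\in\mathcal S_{\mathrm b}$ for all $t\ge0$. Let $\tilde f(x)=f(x)+g(x)u_{\mathrm b}(x)$, and let $\phi:\mathbb{R}^n\times[0,\infty)\to\mathbb{R}^n$ satisfy $\phi(x,\tau)=x+\int_0^\tau\tilde f(\phi(x,s))\,ds$; i.e. $\phi(x,\tau)$ is the solution at time $\tau$ under $u=u_{\mathrm b}$ with initial condition $x$. Prediction sets: $T>0$, $N$ is a positive integer, $T_{\mathrm s}=T/N$, and $$h_*(x)=\min\Big\{h_{\mathrm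 b}(\phi(x,T)),\ \min_{\tau\in[0,T]}h_{\mathrm s}(\phi(x,\tau))\Big\},\qquad \mathcal S_*=\{x\in\mathbb{R}^n: h_*(x)\ge0\},$$ $$\bar h_*(x)=\min\Big\{h_{\mathrm b}(\phi(x,NT_{\mathrm s})),\ \min_{i\in\{0,\dots,N\}}h_{\mathrm s}(\phi(x,iT_{\mathrm s}))\Big\},\qquad \bar{\mathcal S}_*=\{x\in\mathbb{R}^n:\bar h_*(x)\ge0\}.$$ Soft-minimum barrier function: for $\rho>0$, $\mathrm{softmin}_\rho(z_1,\dots,z_M)=-\frac1\rho\log\sum_{i=1}^M e^{-\rho z_i}$, and $$h(x)=\mathrm{softmin}_\rho\big(h_{\mathrm s}(\phi(x,0)),h_{\mathrm s}(\phi(x,T_{\mathrm s})),\dots,h_{\mathrm s}(\phi(x,NT_{\mathrm s})),h_{\mathrm b}(\phi(x,NT_{\mathrm s}))\big),$$ which is continuously differentiable; $\mathcal S=\{x\in\mathbb{R}^n:h(x)\ge0\}$. Lie derivatives: $L_fh(x)=\frac{\partial h(x)}{\partial x}f(x)$, $L_gh(x)=\frac{\partial h(x)}{\partial x}g(x)$. Control ingredients: $\alpha>0$ and $\epsilon\in[0,\sup_{x\in\mathcal S}h(x))$; $$\beta(x)=L_fh(x)+\alpha(h(x)-\epsilon)+\max_{\hat u\in\mathcal U}L_gh(x)\hat u,$$ $$\gamma(x)=\min\{h(x)-\epsilon,\beta(x)\},\qquad \Gamma=\{x\in\mathbb{R}^n:\gamma(x)\ge0\}.$$ The desired control is a function $u_{\mathrm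 d}:\mathbb{R}^n\to\mathbb{R}^m$ (not necessarily admissible). For $x\in\Gamma$, $$u_*(x)=\operatorname*{argmin}_{\hat u\in\mathcal U}\|\hat u-u_{\mathrm d}(x)\|^2\quad\text{subject to}\quad L_fh(x)+L_gh(x)\hat u+\alpha(h(x)-\epsilon)\ge0,$$ where $\|\cdot\|$ is the Euclidean norm; this quadratic program is feasible for every $x\in\Gamma$. Let $\kappa>0$; $\sigma:\mathbb{R}\to[0,1]$ is continuous, $\sigma(a)=0$ for $a\le0$, $\sigma(a)=1$ for $a\ge\kappa$, and $\sigma$ is strictly increasing on $[0,\kappa]$. Constants in (d): $l_{\mathrm s}$ is the Lipschitz constant of $h_{\mathrm s}$ with respect to the Euclidean norm, and $l_\phi=\sup_{x\in\bar{\mathcal S}_*}\|f(x)+g(x)u_{\mathrm b}(x)\|_2$, which is finite if $\mathcal S_{\mathrm s}$ is bounded.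
   Formalization: Part (a) is proved under the additional assumption that the desired control u_d is continuous; for an arbitrary function u_d the continuity of u can fail. Parts (b), (c), (d) are proved for arbitrary u_d. *)

theory Defs
  imports "HOL-Analysis.Analysis"
begin

definition C1 :: "('a::real_normed_vector \<Rightarrow> 'b::real_normed_vector) \<Rightarrow> bool" where
  "C1 F \<longleftrightarrow> (\<exists>F' :: 'a \<Rightarrow> 'a \<Rightarrow>\<^sub>L 'b.
     (\<forall>x. (F has_derivative blinfun_apply (F' x)) (at x)) \<and> continuous_on UNIV F')"

definition admissible :: "real^'m^'r \<Rightarrow> real^'r \<Rightarrow> (real^'m) set" where
  "admissible A b = {u. \<forall>i. (A *v u) $ i \<le> b $ i}"

definition nonneg_set :: "('a \<Rightarrow> real) \<Rightarrow> 'a set" where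
  "nonneg_set h = {x. h x \<ge> 0}"

definition closed_loop_field ::
  "(real^'n \<Rightarrow> real^'n) \<Rightarrow> (real^'n \<Rightarrow> real^'m^'n) \<Rightarrow> (real^'n \<Rightarrow> real^'m) \<Rightarrow> real^'n \<Rightarrow> real^'n" where
  "closed_loop_field f g u x = f x + g x *v u x"

(* Only the values of x on [0, infinity) matter; the derivative at time 0 is one-sided. *)
definition closed_loop_solution ::
  "(real^'n \<Rightarrow> real^'n) \<Rightarrow> (real^'n \<Rightarrow> real^'m^'n) \<Rightarrow> (real^'n \<Rightarrow> real^'m)
    \<Rightarrow> (real \<Rightarrow> real^'n) \<Rightarrow> bool" where
  "closed_loop_solution f g u x \<longleftrightarrow>
     (\<forall>t\<ge>0. (x has_vector_derivative closed_loop_field f g u (x t)) (at t within {0..}))"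

definition forward_invariant ::
  "(real^'n \<Rightarrow> real^'n) \<Rightarrow> (real^'n \<Rightarrow> real^'m^'n) \<Rightarrow> (real^'n \<Rightarrow> real^'m)
    \<Rightarrow> (real^'n) set \<Rightarrow> bool" where
  "forward_invariant f g u S \<longleftrightarrow>
     (\<forall>x. closed_loop_solution f g u x \<and> x 0 \<in> S \<longrightarrow> (\<forall>t\<ge>0. x t \<in> S))"

(* The explicit integrability conjunct is needed because integral is 0 on
   non-integrable functions. *)
definition flow_of :: "(real^'n \<Rightarrow> real^'n) \<Rightarrow> (real^'n \<Rightarrow> real \<Rightarrow> real^'n) \<Rightarrow> bool" where
  "flow_of F phi \<longleftrightarrow>
     (\<forall>x. \<forall>\<tau>\<ge>0. (\<lambda>s. F (phi x s)) integrable_on {0..\<tau>} \<and>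
                phi x \<tau> = x + integral {0..\<tau>} (\<lambda>s. F (phi x s)))"

(* The infimum is attained for a flow phi and continuous hs, so it is the minimum over [0,T]. *)
definition h_star ::
  "('a \<Rightarrow> real) \<Rightarrow> ('a \<Rightarrow> real) \<Rightarrow> ('a \<Rightarrow> real \<Rightarrow> 'a) \<Rightarrow> real \<Rightarrow> 'a \<Rightarrow> real" where
  "h_star hs hb phi T x = min (hb (phi x T)) (INF \<tau>\<in>{0..T}. hs (phi x \<tau>))"

definition h_bar_star ::
  "('a \<Rightarrow> real) \<Rightarrow> ('a \<Rightarrow> real) \<Rightarrow> ('a \<Rightarrow> real \<Rightarrow> 'a) \<Rightarrow> nat \<Rightarrow> real \<Rightarrow> 'a \<Rightarrow> real" where
  "h_bar_star hs hb phi N Ts x =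
     min (hb (phi x (real N * Ts))) (MIN i\<in>{0..N}. hs (phi x (real i * Ts)))"

definition softmin :: "real \<Rightarrow> real list \<Rightarrow> real" where
  "softmin \<rho> zs = - (1 / \<rho>) * ln (\<Sum>z\<leftarrow>zs. exp (- \<rho> * z))"

definition softmin_barrier ::
  "('a \<Rightarrow> real) \<Rightarrow> ('a \<Rightarrow> real) \<Rightarrow> ('a \<Rightarrow> real \<Rightarrow> 'a) \<Rightarrow> nat \<Rightarrow> real \<Rightarrow> real \<Rightarrow> 'a \<Rightarrow> real" where
  "softmin_barrier hs hb phi N Ts \<rho> x =
     softmin \<rho> (map (\<lambda>i. hs (phi x (real i * Ts))) [0..<Suc N] @ [hb (phi x (real N * Ts))])"

definition grad :: "(real^'n \<Rightarrow> real) \<Rightarrow> real^'n \<Rightarrow> real^'n" where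
  "grad h x = (\<chi> i. frechet_derivative h (at x) (axis i 1))"

definition Lie_f :: "(real^'n \<Rightarrow> real^'n) \<Rightarrow> (real^'n \<Rightarrow> real) \<Rightarrow> real^'n \<Rightarrow> real" where
  "Lie_f f h x = grad h x \<bullet> f x"

(* A row vector of length m; its product with a column vector v is Lie_g g h x \<bullet> v. *)
definition Lie_g :: "(real^'n \<Rightarrow> real^'m^'n) \<Rightarrow> (real^'n \<Rightarrow> real) \<Rightarrow> real^'n \<Rightarrow> real^'m" where
  "Lie_g g h x = grad h x v* g x"

(* The supremum is attained when U is nonempty and compact, so it is then a maximum. *)
definition beta ::
  "(real^'n \<Rightarrow> real^'n) \<Rightarrow> (real^'n \<Rightarrow> real^'m^'n) \<Rightarrow> (real^'m) set \<Rightarrow> (real^'n \<Rightarrow> real)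
    \<Rightarrow> real \<Rightarrow> real \<Rightarrow> real^'n \<Rightarrow> real" where
  "beta f g U h \<alpha> \<epsilon> x = Lie_f f h x + \<alpha> * (h x - \<epsilon>) + (SUP v\<in>U. Lie_g g h x \<bullet> v)"

definition gamma ::
  "(real^'n \<Rightarrow> real^'n) \<Rightarrow> (real^'n \<Rightarrow> real^'m^'n) \<Rightarrow> (real^'m) set \<Rightarrow> (real^'n \<Rightarrow> real)
    \<Rightarrow> real \<Rightarrow> real \<Rightarrow> real^'n \<Rightarrow> real" where
  "gamma f g U h \<alpha> \<epsilon> x = min (h x - \<epsilon>) (beta f g U h \<alpha> \<epsilon> x)"

definition qp_control ::
  "(real^'n \<Rightarrow> real^'n) \<Rightarrow> (real^'n \<Rightarrow> real^'m^'n) \<Rightarrow> (real^'m) set \<Rightarrow> (real^'n \<Rightarrow> real)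
    \<Rightarrow> real \<Rightarrow> real \<Rightarrow> (real^'n \<Rightarrow> real^'m) \<Rightarrow> real^'n \<Rightarrow> real^'m" where
  "qp_control f g U h \<alpha> \<epsilon> ud x =
     arg_min (\<lambda>v. (norm (v - ud x))\<^sup>2)
       (\<lambda>v. v \<in> U \<and> Lie_f f h x + Lie_g g h x \<bullet> v + \<alpha> * (h x - \<epsilon>) \<ge> 0)"

definition blended_control ::
  "(real \<Rightarrow> real) \<Rightarrow> ('a \<Rightarrow> real) \<Rightarrow> ('a \<Rightarrow> real^'m) \<Rightarrow> ('a \<Rightarrow> real^'m) \<Rightarrow> 'a \<Rightarrow> real^'m" where
  "blended_control \<sigma> \<gamma> ub us x =
     (if x \<in> nonneg_set \<gamma>
      then (1 - \<sigma> (\<gamma> x)) *\<^sub>R ub x + \<sigma> (\<gamma> x) *\<^sub>R us x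
      else ub x)"

(* Extended-real valued, so that it is infinite (and not a junk value) on an unbounded image. *)
definition max_speed :: "('a \<Rightarrow> real^'n) \<Rightarrow> 'a set \<Rightarrow> ereal" where
  "max_speed F S = (SUP x\<in>S. ereal (norm (F x)))"

end

theory Submission
  imports Defs
begin

text \<open>
  Continuity of the feedback: where \<open>\<gamma> > 0\<close> the quadratic program satisfies Slater's condition, so its
  minimiser depends continuously on the state; where \<open>\<gamma> \<le> 0\<close> the weight of the bounded minimiser
  vanishes.

  Safety: the soft minimum lies strictly below each of its arguments, so every state with
  \<open>h \<ge> 0\<close> is in the sampled prediction set, and the feedback equals the backup control wherever
  \<open>h \<le> \<epsilon>\<close>. Hence over one sampling period the trajectory either visits \<open>h \<ge> 0\<close> or follows the
  backup flow, and both lead to the sampled set. For (d), \<open>h > \<epsilon>\<close> implies membership in the continuous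
  prediction set. To see this, let \<open>r \<le> T_s / 2\<close> be the least offset from the sampling times at which \<open>h_s\<close>
  is nonpositive. Up to \<open>r\<close> all the offset points lie in the sampled set, where the speed bound
  holds, so \<open>h_s\<close> has dropped by at most \<open>\<epsilon>\<close>, a contradiction. Outside the continuous prediction set the
  trajectory therefore follows the backup flow, which cannot leave that set.
\<close>

section \<open>Differential equations with a locally Lipschitz field\<close>

text \<open>The continuous derivative is bounded on the compact ball, and the ball is convex, so the
  mean value inequality applies.\<close>

lemma C1_lipschitz_on_cball:
  fixes F :: "'a::euclidean_space \<Rightarrow> 'b::real_normed_vector"
  assumes "C1 F"
  shows "\<exists>L. L-lipschitz_on (cball a R) F"
proof -
  obtain F' :: "'a \<Rightarrow> 'a \<Rightarrow>\<^sub>L 'b"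
    where der: "\<And>x. (F has_derivative blinfun_apply (F' x)) (at x)" and cont: "continuous_on UNIV F'"
    using assms unfolding C1_def by blast
  have "compact (F' ` cball a R)"
    using cont by (intro compact_continuous_image) (auto intro: continuous_on_subset)
  then obtain B where B: "\<And>x. x \<in> cball a R \<Longrightarrow> norm (F' x) \<le> B"
    by (metis bounded_iff compact_imp_bounded image_eqI)
  \<comment> \<open>For negative \<open>R\<close> the ball is empty and \<open>B\<close> may be
    negative, hence the maximum with 0.\<close>
  have "(max B 0)-lipschitz_on (cball a R) F"
  proof (rule bounded_derivative_imp_lipschitz)
    show "\<And>x. x \<in> cball a R \<Longrightarrow> (F has_derivative blinfun_apply (F' x)) (at x within cball a R)"
      using der by (blast intro: has_derivative_at_withinI)
    show "\<And>x. x \<in> cball a R \<Longrightarrow> onorm (blinfun_apply (F' x)) \<le> max B 0"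
      using B by (fastforce simp: norm_blinfun.rep_eq)
  qed auto
  then show ?thesis ..
qed

lemma C1_imp_continuous_on: "C1 F \<Longrightarrow> continuous_on S F"
  unfolding C1_def by (metis continuous_at_imp_continuous_on has_derivative_continuous)

lemma bounded_bilinear_matrix_vector_mult:
  "bounded_bilinear (\<lambda>(A::real^'m^'n) v. A *v v)"
proof -
  have "bilinear (\<lambda>(A::real^'m^'n) v. A *v v)"
    unfolding bilinear_def
    by (auto intro!: linearI simp: matrix_vector_mult_add_rdistrib matrix_vector_right_distrib
        matrix_vector_mult_scaleR scaleR_matrix_vector_assoc)
  then show ?thesis by (simp add: bilinear_conv_bounded_bilinear)
qed

lemma (in bounded_bilinear) lipschitz_on_prod:
  assumes f: "L-lipschitz_on X f" and g: "M-lipschitz_on X g"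
    and "bounded (f ` X)" "bounded (g ` X)"
  shows "\<exists>K. K-lipschitz_on X (\<lambda>x. prod (f x) (g x))"
proof -
  obtain K where "K > 0" and K: "\<And>a b. norm (prod a b) \<le> norm a * norm b * K"
    using pos_bounded by blast
  obtain B where "B > 0" and B: "\<And>x. x \<in> X \<Longrightarrow> norm (f x) \<le> B"
    using assms(3) by (auto simp: bounded_pos)
  obtain C where "C > 0" and C: "\<And>x. x \<in> X \<Longrightarrow> norm (g x) \<le> C"
    using assms(4) by (auto simp: bounded_pos)
  have "L \<ge> 0" "M \<ge> 0" using f g by (auto simp: lipschitz_on_def)
  have "((L * C + B * M) * K)-lipschitz_on X (\<lambda>x. prod (f x) (g x))"
  proof (rule lipschitz_onI)
    fix x y assume xy: "x \<in> X" "y \<in> X"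
    \<comment> \<open>Telescoping through \<open>prod (f y) (g x)\<close>.\<close>
    have "prod (f x) (g x) - prod (f y) (g y) = prod (f x - f y) (g x) + prod (f y) (g x - g y)"
      by (simp add: diff_left diff_right)
    then have "norm (prod (f x) (g x) - prod (f y) (g y))
        \<le> norm (prod (f x - f y) (g x)) + norm (prod (f y) (g x - g y))"
      by (simp add: norm_triangle_ineq)
    also have "\<dots> \<le> norm (f x - f y) * norm (g x) * K + norm (f y) * norm (g x - g y) * K"
      by (intro add_mono K)
    also have "\<dots> \<le> (L * dist x y) * C * K + B * (M * dist x y) * K"
      using xy lipschitz_onD[OF f xy] lipschitz_onD[OF g xy] B C \<open>K > 0\<close> \<open>B > 0\<close> \<open>L \<ge> 0\<close>
      by (intro add_mono mult_right_mono mult_mono) (auto simp: dist_norm)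
    finally show "dist (prod (f x) (g x)) (prod (f y) (g y)) \<le> ((L * C + B * M) * K) * dist x y"
      by (simp add: dist_norm algebra_simps)
  qed (use \<open>L \<ge> 0\<close> \<open>M \<ge> 0\<close> \<open>B > 0\<close> \<open>C > 0\<close> \<open>K > 0\<close> in auto)
  then show ?thesis ..
qed

lemma closed_loop_field_lipschitz_on_cball:
  fixes f :: "real^'n \<Rightarrow> real^'n"
  assumes "C1 f" "C1 g" "C1 u"
  shows "\<exists>L. L-lipschitz_on (cball 0 R) (closed_loop_field f g u)"
proof -
  have bdd: "bounded (k ` cball 0 R)" if "C1 k" for k :: "real^'n \<Rightarrow> 'b::real_normed_vector"
    by (intro compact_imp_bounded compact_continuous_image C1_imp_continuous_on that) simp
  obtain L where L: "L-lipschitz_on (cball 0 R) g"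
    using C1_lipschitz_on_cball[OF assms(2)] ..
  obtain M where M: "M-lipschitz_on (cball 0 R) u"
    using C1_lipschitz_on_cball[OF assms(3)] ..
  obtain K where K: "K-lipschitz_on (cball 0 R) (\<lambda>x. g x *v u x)"
    using bounded_bilinear.lipschitz_on_prod[OF bounded_bilinear_matrix_vector_mult L M
        bdd[OF assms(2)] bdd[OF assms(3)]] ..
  obtain J where J: "J-lipschitz_on (cball 0 R) f"
    using C1_lipschitz_on_cball[OF assms(1)] ..
  show ?thesis
    unfolding closed_loop_field_def using lipschitz_on_add[OF J K] ..
qed

section \<open>Comparison, continuous dependence and uniqueness of solutions\<close>

lemma gronwall_solutions:
  fixes y z :: "real \<Rightarrow> 'a::real_inner"
  assumes F: "L-lipschitz_on X F"
    and y: "\<And>s. s \<in> {0..\<tau>} \<Longrightarrow> (y has_vector_derivative F (y s)) (at s within {0..\<tau>})"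
    and z: "\<And>s. s \<in> {0..\<tau>} \<Longrightarrow> (z has_vector_derivative F (z s)) (at s within {0..\<tau>})"
    and X: "\<And>s. s \<in> {0..\<tau>} \<Longrightarrow> y s \<in> X \<and> z s \<in> X"
    and t: "t \<in> {0..\<tau>}"
  shows "dist (z t) (y t) \<le> exp (L * t) * dist (z 0) (y 0)"
proof -
  define w where "w s = z s - y s" for s
  \<comment> \<open>Gronwall in differential form: by Cauchy-Schwarz the derivative of
    \<open>w s \<bullet> w s\<close> is at most \<open>2 * L\<close> times itself, so the
    exponential weight makes \<open>D\<close> nonincreasing. Squaring keeps \<open>D\<close>
    differentiable where the two solutions meet.\<close>
  define D where "D s = exp (- 2 * L * s) * (w s \<bullet> w s)" for s
  have w: "(w has_vector_derivative F (z s) - F (y s)) (at s within {0..\<tau>})" if "s \<in> {0..\<tau>}" for s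
    unfolding w_def using y z that by (intro derivative_intros) auto
  have cont: "continuous_on {0..\<tau>} w"
    using w has_vector_derivative_continuous continuous_on_eq_continuous_within by blast
  have "D t \<le> D 0"
  proof (rule DERIV_nonpos_imp_decreasing_open[where f = D])
    fix s assume s: "0 < s" "s < t"
    then have sI: "s \<in> {0..\<tau>}" "at s within {0..\<tau>} = at s"
      using t by (auto intro!: at_within_Icc_at)
    have wd: "(w has_vector_derivative F (z s) - F (y s)) (at s)"
      using w[OF sI(1)] sI(2) by simp
    have "((\<lambda>s. w s \<bullet> w s) has_real_derivative 2 * (w s \<bullet> (F (z s) - F (y s)))) (at s)"
      using wd unfolding has_vector_derivative_def has_field_derivative_def
      by (auto intro!: derivative_eq_intros simp: fun_eq_iff inner_commute algebra_simps)
    then have "(D has_real_derivative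
        exp (- 2 * L * s) * (2 * (w s \<bullet> (F (z s) - F (y s))) - 2 * L * (w s \<bullet> w s))) (at s)"
      unfolding D_def by (auto intro!: derivative_eq_intros simp: algebra_simps)
    moreover have "w s \<bullet> (F (z s) - F (y s)) \<le> L * (w s \<bullet> w s)"
    proof -
      have "w s \<bullet> (F (z s) - F (y s)) \<le> norm (w s) * norm (F (z s) - F (y s))"
        by (rule norm_cauchy_schwarz)
      also have "\<dots> \<le> norm (w s) * (L * norm (w s))"
        using lipschitz_onD[OF F, of "z s" "y s"] X[OF sI(1)]
        by (intro mult_left_mono) (auto simp: dist_norm w_def)
      finally show ?thesis by (simp add: dot_square_norm power2_eq_square algebra_simps)
    qed
    ultimately show "\<exists>D'. (D has_real_derivative D') (at s) \<and> D' \<le> 0"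
      by (intro exI conjI) (auto simp: mult_le_0_iff)
  next
    show "continuous_on {0..t} D"
      unfolding D_def using t
      by (intro continuous_intros continuous_on_subset[OF cont]) auto
  qed (use t in auto)
  moreover have "exp (2 * (L * t)) * D t = (norm (w t))\<^sup>2"
    by (simp add: D_def dot_square_norm mult.assoc exp_minus)
  moreover have "exp (2 * (L * t)) * D 0 = (exp (L * t) * norm (w 0))\<^sup>2"
    by (simp add: D_def dot_square_norm power_mult_distrib exp_double)
  ultimately have "(norm (w t))\<^sup>2 \<le> (exp (L * t) * norm (w 0))\<^sup>2"
    by (metis exp_ge_zero mult_left_mono)
  then have "norm (w t) \<le> exp (L * t) * norm (w 0)"
    by (rule power2_le_imp_le) simp
  then show ?thesis by (simp add: w_def dist_norm)
qed

text \<open>The field is Lipschitz only on balls, so a fixed constant is taken on a ball that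
  contains the unit tube around \<open>y\<close>. A solution starting within
  \<open>exp (- L * \<tau>)\<close> of \<open>y\<close> cannot leave that tube before time \<tau>,
  so the Gronwall estimate holds for it throughout. The filter is arbitrary, so that both sequences
  and \<open>at x\<close> are covered.\<close>

lemma solution_tendsto:
  fixes y :: "real \<Rightarrow> 'a::real_inner"
  assumes F: "\<And>R. \<exists>L. L-lipschitz_on (cball 0 R) F"
    and y: "\<And>s. s \<in> {0..\<tau>} \<Longrightarrow> (y has_vector_derivative F (y s)) (at s within {0..\<tau>})"
    and Z: "\<And>a s. s \<in> {0..\<tau>} \<Longrightarrow> (Z a has_vector_derivative F (Z a s)) (at s within {0..\<tau>})"
    and lim: "((\<lambda>a. Z a 0) \<longlongrightarrow> y 0) G" and "t \<in> {0..\<tau>}"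
  shows "((\<lambda>a. Z a t) \<longlongrightarrow> y t) G"
proof -
  have cont: "continuous_on {0..\<tau>} v"
    if "\<And>s. s \<in> {0..\<tau>} \<Longrightarrow> (v has_vector_derivative F (v s)) (at s within {0..\<tau>})"
    for v :: "real \<Rightarrow> 'a"
    using that has_vector_derivative_continuous continuous_on_eq_continuous_within by blast
  have "bounded (y ` {0..\<tau>})"
    by (intro compact_imp_bounded compact_continuous_image cont y) auto
  then obtain R where R: "\<And>s. s \<in> {0..\<tau>} \<Longrightarrow> norm (y s) \<le> R"
    unfolding bounded_iff by blast
  obtain L where L: "L-lipschitz_on (cball 0 (R + 1)) F" using F by blast
  have "L \<ge> 0" using L by (simp add: lipschitz_on_def)
  have main: "dist (z t) (y t) \<le> exp (L * t) * dist (z 0) (y 0)"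
    if z: "\<And>s. s \<in> {0..\<tau>} \<Longrightarrow> (z has_vector_derivative F (z s)) (at s within {0..\<tau>})"
      and d: "dist (z 0) (y 0) < exp (- L * \<tau>)" and t: "t \<in> {0..\<tau>}" for z t
  proof -
    have in_ball: "y s \<in> cball 0 (R + 1) \<and> z s \<in> cball 0 (R + 1)"
      if "s \<in> {0..\<tau>}" "dist (z s) (y s) \<le> 1" for s
      using R[OF that(1)] that(2) norm_triangle_ineq2[of "z s" "y s"] by (auto simp: dist_norm)
    have est: "dist (z s) (y s) \<le> exp (L * s) * dist (z 0) (y 0)"
      if s: "s \<in> {0..\<tau>}" and close: "\<And>r. r \<in> {0..s} \<Longrightarrow> dist (z r) (y r) \<le> 1" for s
    proof (rule gronwall_solutions[OF L, where \<tau>=s])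
      show "\<And>r. r \<in> {0..s} \<Longrightarrow> (y has_vector_derivative F (y r)) (at r within {0..s})"
        using s by (intro has_vector_derivative_within_subset[OF y]) auto
      show "\<And>r. r \<in> {0..s} \<Longrightarrow> (z has_vector_derivative F (z r)) (at r within {0..s})"
        using s by (intro has_vector_derivative_within_subset[OF z]) auto
      show "\<And>r. r \<in> {0..s} \<Longrightarrow> y r \<in> cball 0 (R + 1) \<and> z r \<in> cball 0 (R + 1)"
        using s close in_ball by simp
    qed (use s in auto)
    have "dist (z r) (y r) < 1" if r: "r \<in> {0..\<tau>}" for r
    proof (rule ccontr)
      assume far: "\<not> dist (z r) (y r) < 1"
      \<comment> \<open>The first exit time \<open>m\<close> from the tube: the estimate is valid up
        to and including \<open>m\<close>, and there it gives a distance below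
        \<open>exp (L * m) * exp (- L * \<tau>)\<close>, hence below 1.\<close>
      define E where "E = {s \<in> {0..\<tau>}. 1 \<le> dist (z s) (y s)}"
      have "closed E"
        unfolding E_def
        by (intro continuous_on_closed_Collect_le continuous_intros cont[OF y] cont[OF z]) auto
      moreover have "E \<noteq> {}" "bdd_below E"
        using r far by (auto simp: E_def intro!: bdd_belowI[of _ 0])
      ultimately have mE: "Inf E \<in> E" by (intro closed_contains_Inf)
      define m where "m = Inf E"
      have m: "m \<in> {0..\<tau>}" "1 \<le> dist (z m) (y m)" using mE by (auto simp: E_def m_def)
      have before: "dist (z s) (y s) < 1" if "s \<in> {0..<m}" for s
        using that m cInf_lower[OF _ \<open>bdd_below E\<close>, of s] by (force simp: E_def m_def)
      have "dist (z 0) (y 0) < 1"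
      proof -
        have "exp (- L * \<tau>) \<le> 1" using \<open>L \<ge> 0\<close> r by simp
        with d show ?thesis by linarith
      qed
      with m have "m > 0" by (cases "m = 0") auto
      have "dist (z s) (y s) \<le> 1" if "s \<in> {0..m}" for s
      proof (rule continuous_le_on_closure[where S="{0..<m}" and f="\<lambda>s. dist (z s) (y s)"])
        show "continuous_on (closure {0..<m}) (\<lambda>s. dist (z s) (y s))"
          using \<open>m > 0\<close> m
          by (intro continuous_intros continuous_on_subset[OF cont[OF y]] continuous_on_subset[OF cont[OF z]]) auto
      qed (use \<open>m > 0\<close> that before in \<open>auto simp: less_imp_le\<close>)
      then have "dist (z m) (y m) \<le> exp (L * m) * dist (z 0) (y 0)"
        using est m by blast
      also have "\<dots> < exp (L * m) * exp (- L * \<tau>)" using d by simp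
      also have "\<dots> \<le> 1" using m \<open>L \<ge> 0\<close> by (simp add: mult_left_mono flip: exp_add)
      finally show False using m by simp
    qed
    then show ?thesis using est[OF t] t by (simp add: less_imp_le)
  qed
  have "\<forall>\<^sub>F a in G. dist (Z a 0) (y 0) < exp (- L * \<tau>)"
    using lim by (rule tendstoD) simp
  then have "\<forall>\<^sub>F a in G. norm (dist (Z a t) (y t)) \<le> exp (L * t) * dist (Z a 0) (y 0)"
    by (rule eventually_mono) (use main[OF Z _ \<open>t \<in> {0..\<tau>}\<close>] in simp)
  moreover have "((\<lambda>a. exp (L * t) * dist (Z a 0) (y 0)) \<longlongrightarrow> 0) G"
    by (rule tendsto_mult_right_zero[OF lim[THEN tendsto_dist_iff[THEN iffD1]]])
  ultimately have "((\<lambda>a. dist (Z a t) (y t)) \<longlongrightarrow> 0) G"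
    by (rule Lim_null_comparison)
  then show ?thesis by (rule tendsto_dist_iff[THEN iffD2])
qed

text \<open>Continuous dependence for a constant family, followed by uniqueness of limits.\<close>

lemma solution_unique:
  fixes y z :: "real \<Rightarrow> 'a::real_inner"
  assumes "\<And>R. \<exists>L. L-lipschitz_on (cball 0 R) F"
    and "\<And>s. s \<in> {0..\<tau>} \<Longrightarrow> (y has_vector_derivative F (y s)) (at s within {0..\<tau>})"
    and "\<And>s. s \<in> {0..\<tau>} \<Longrightarrow> (z has_vector_derivative F (z s)) (at s within {0..\<tau>})"
    and "z 0 = y 0" and "t \<in> {0..\<tau>}"
  shows "z t = y t"
proof -
  have "(\<lambda>_. z t) \<longlonglongrightarrow> y t"
    by (rule solution_tendsto[where Z = "\<lambda>_. z", OF assms(1,2,3)]) (use assms(4,5) in auto)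
  then show ?thesis by (simp add: LIMSEQ_const_iff)
qed

lemma shifted_solution:
  fixes z :: "real \<Rightarrow> 'a::real_normed_vector"
  assumes "\<And>t. t \<ge> 0 \<Longrightarrow> (z has_vector_derivative F (z t)) (at t within {0..})"
    and "c \<ge> 0" "t \<ge> 0"
  shows "((\<lambda>s. z (c + s)) has_vector_derivative F (z (c + t))) (at t within {0..})"
proof -
  have "(z has_vector_derivative F (z (c + t))) (at (c + t) within (\<lambda>s. c + s) ` {0..})"
    by (rule has_vector_derivative_within_subset[OF assms(1)]) (use assms in auto)
  moreover have "((\<lambda>s. c + s) has_vector_derivative 1) (at t within {0..})"
    by (auto intro!: derivative_eq_intros)
  ultimately have "(z \<circ> (\<lambda>s. c + s) has_vector_derivative 1 *\<^sub>R F (z (c + t))) (at t within {0..})"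
    by (intro vector_diff_chain_within) auto
  then show ?thesis by (simp add: o_def)
qed

section \<open>The semiflow defined by the integral equation of a locally Lipschitz field\<close>

locale semiflow =
  fixes F :: "real^'n \<Rightarrow> real^'n" and \<phi> :: "real^'n \<Rightarrow> real \<Rightarrow> real^'n"
  assumes lipschitz: "\<And>R. \<exists>L. L-lipschitz_on (cball 0 R) F"
    and flow: "flow_of F \<phi>"
begin

lemma flow_zero [simp]: "\<phi> x 0 = x"
  using flow unfolding flow_of_def by (metis add.right_neutral integral_refl order_refl box_real(2))

lemma continuous_field: "continuous_on S F"
proof -
  have "isCont F x" for x
  proof -
    obtain L where "L-lipschitz_on (cball 0 (norm x + 1)) F" using lipschitz by blast
    then have "continuous_on (cball 0 (norm x + 1)) F" by (rule lipschitz_on_continuous_on)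
    moreover have "x \<in> interior (cball 0 (norm x + 1))" by simp
    ultimately show ?thesis by (rule continuous_on_interior)
  qed
  then show ?thesis by (rule continuous_at_imp_continuous_on[rule_format])
qed

text \<open>A bootstrap: an indefinite integral is continuous, so the flow line is continuous, so
  its integrand is continuous, and the fundamental theorem of calculus applies.\<close>

lemma flow_has_vector_derivative:
  assumes "t \<ge> 0"
  shows "(\<phi> x has_vector_derivative F (\<phi> x t)) (at t within {0..})"
proof -
  \<comment> \<open>The extra unit keeps \<open>t\<close> away from the right endpoint, so that at
    \<open>t\<close> the derivatives within \<open>?I\<close> and within \<open>{0..}\<close>
    coincide.\<close>
  let ?I = "{0..t + 1}"
  have eq: "\<phi> x s = x + integral {0..s} (\<lambda>s. F (\<phi> x s))" if "s \<in> ?I" for s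
    using flow that unfolding flow_of_def by auto
  have "(\<lambda>s. F (\<phi> x s)) integrable_on ?I"
    using flow assms unfolding flow_of_def by auto
  then have "continuous_on ?I (\<lambda>s. x + integral {0..s} (\<lambda>s. F (\<phi> x s)))"
    by (intro continuous_intros indefinite_integral_continuous_1)
  then have "continuous_on ?I (\<phi> x)"
    by (subst continuous_on_cong[OF refl eq]) auto
  then have "continuous_on ?I (\<lambda>s. F (\<phi> x s))"
    by (intro continuous_on_compose2[OF continuous_field]) auto
  then have "((\<lambda>s. x + integral {0..s} (\<lambda>s. F (\<phi> x s))) has_vector_derivative F (\<phi> x t)) (at t within ?I)"
    using assms by (auto intro!: derivative_eq_intros integral_has_vector_derivative)
  then have "(\<phi> x has_vector_derivative F (\<phi> x t)) (at t within ?I)"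
    by (rule has_vector_derivative_transform[rotated 2]) (use assms eq in auto)
  moreover have "at t within ?I = at t within {0..}"
    by (rule at_within_nhd[where S = "{..<t + 1}"]) auto
  ultimately show ?thesis by simp
qed

lemma continuous_on_flow_time: "continuous_on {0..} (\<phi> x)"
  using flow_has_vector_derivative has_vector_derivative_continuous
  unfolding continuous_on_eq_continuous_within by (metis atLeast_iff)

lemma flow_unique:
  assumes z: "\<And>s. s \<in> {0..\<tau>} \<Longrightarrow> (z has_vector_derivative F (z s)) (at s within {0..\<tau>})"
    and t: "t \<in> {0..\<tau>}"
  shows "z t = \<phi> (z 0) t"
proof -
  have "(\<phi> (z 0) has_vector_derivative F (\<phi> (z 0) s)) (at s within {0..\<tau>})" if "s \<in> {0..\<tau>}" for s
    by (rule has_vector_derivative_within_subset[OF flow_has_vector_derivative]) (use that in auto)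
  then show ?thesis
    by (rule solution_unique[OF lipschitz _ z _ t]) auto
qed

text \<open>The time shift of a flow line solves the same autonomous equation, so uniqueness
  applies.\<close>

lemma flow_add:
  assumes "s \<ge> 0" "t \<ge> 0"
  shows "\<phi> (\<phi> x s) t = \<phi> x (s + t)"
proof -
  have "((\<lambda>r. \<phi> x (s + r)) has_vector_derivative F (\<phi> x (s + r))) (at r within {0..t})"
    if "r \<in> {0..t}" for r
    by (rule has_vector_derivative_within_subset[OF shifted_solution[OF flow_has_vector_derivative]])
      (use that assms in auto)
  from flow_unique[OF this, of t] assms show ?thesis by simp
qed

lemma continuous_on_flow_space:
  assumes "t \<ge> 0"
  shows "continuous_on X (\<lambda>x. \<phi> x t)"
proof -
  have "isCont (\<lambda>x. \<phi> x t) x" for x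
  proof -
    have der: "(\<phi> y has_vector_derivative F (\<phi> y s)) (at s within {0..t})" if "s \<in> {0..t}" for s y
      by (rule has_vector_derivative_within_subset[OF flow_has_vector_derivative]) (use that in auto)
    show ?thesis
      unfolding isCont_def
      by (rule solution_tendsto[where Z = \<phi>, OF lipschitz der der]) (use assms in auto)
  qed
  then show ?thesis by (rule continuous_at_imp_continuous_on[rule_format])
qed

end

section \<open>Prediction sets of the backup flow\<close>

text \<open>A second entry adds a positive term, so the exponential sum strictly exceeds each of its
  terms. For a one-entry list the soft minimum is the entry itself.\<close>

lemma softmin_less:
  assumes "\<rho> > 0" "z \<in> set zs" "length zs \<ge> 2"
  shows "softmin \<rho> zs < z"
proof -
  obtain as bs where zs: "zs = as @ z # bs" using assms(2) by (meson split_list)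
  have nn: "0 \<le> (\<Sum>z\<leftarrow>xs. exp (- \<rho> * z))" for xs
    by (rule sum_list_nonneg) auto
  have pos: "0 < (\<Sum>z\<leftarrow>xs. exp (- \<rho> * z))" if "xs \<noteq> []" for xs
    using that nn[of "tl xs"] by (cases xs) (auto intro: add_pos_nonneg)
  have "as \<noteq> [] \<or> bs \<noteq> []" using assms(3) zs by auto
  then have "exp (- \<rho> * z) < (\<Sum>z\<leftarrow>zs. exp (- \<rho> * z))"
    using nn[of as] nn[of bs] pos[of as] pos[of bs] by (auto simp: zs)
  then have "- \<rho> * z < ln (\<Sum>z\<leftarrow>zs. exp (- \<rho> * z))"
    by (metis exp_gt_zero ln_exp ln_less_cancel_iff order_less_trans)
  then show ?thesis using \<open>\<rho> > 0\<close> by (simp add: softmin_def field_simps)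
qed

section \<open>Continuous and sampled prediction sets: closedness and invariance\<close>

locale backup_flow = semiflow F \<phi>
  for F :: "real^'n \<Rightarrow> real^'n" and \<phi> :: "real^'n \<Rightarrow> real \<Rightarrow> real^'n" +
  fixes h_s h_b :: "real^'n \<Rightarrow> real" and T :: real and N :: nat
  assumes T_pos: "T > 0" and N_pos: "N > 0"
    and continuous_h_s: "continuous_on UNIV h_s" and continuous_h_b: "continuous_on UNIV h_b"
    and backup_safe: "\<And>x. h_b x \<ge> 0 \<Longrightarrow> h_s x \<ge> 0"
    and backup_invariant: "\<And>x t. h_b x \<ge> 0 \<Longrightarrow> t \<ge> 0 \<Longrightarrow> h_b (\<phi> x t) \<ge> 0"
begin

definition T_s :: real where "T_s = T / real N"
definition S_star :: "(real^'n) set" where "S_star = nonneg_set (h_star h_s h_b \<phi> T)"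
definition S_bar :: "(real^'n) set" where "S_bar = nonneg_set (h_bar_star h_s h_b \<phi> N T_s)"

lemma T_s_pos: "T_s > 0" and N_T_s: "real N * T_s = T"
  using T_pos N_pos by (auto simp: T_s_def)

lemma mem_S_star: "x \<in> S_star \<longleftrightarrow> h_b (\<phi> x T) \<ge> 0 \<and> (\<forall>\<tau>\<in>{0..T}. h_s (\<phi> x \<tau>) \<ge> 0)"
proof -
  \<comment> \<open>A real infimum bounds its arguments from below only if they are bounded below;
    continuity on the compact horizon provides this.\<close>
  have "continuous_on {0..T} (\<lambda>\<tau>. h_s (\<phi> x \<tau>))"
    by (intro continuous_on_compose2[OF continuous_h_s] continuous_on_subset[OF continuous_on_flow_time]) auto
  then have "bounded ((\<lambda>\<tau>. h_s (\<phi> x \<tau>)) ` {0..T})"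
    by (intro compact_imp_bounded compact_continuous_image) auto
  then have bdd: "bdd_below ((\<lambda>\<tau>. h_s (\<phi> x \<tau>)) ` {0..T})"
    by (rule bounded_imp_bdd_below)
  have "0 \<le> (INF \<tau>\<in>{0..T}. h_s (\<phi> x \<tau>)) \<longleftrightarrow> (\<forall>\<tau>\<in>{0..T}. h_s (\<phi> x \<tau>) \<ge> 0)"
    using T_pos by (intro le_cINF_iff bdd) auto
  then show ?thesis by (simp add: S_star_def nonneg_set_def h_star_def)
qed

lemma mem_S_bar: "x \<in> S_bar \<longleftrightarrow> h_b (\<phi> x T) \<ge> 0 \<and> (\<forall>i\<le>N. h_s (\<phi> x (real i * T_s)) \<ge> 0)"
  by (auto simp: S_bar_def nonneg_set_def h_bar_star_def N_T_s)

lemma S_star_safe: "x \<in> S_star \<Longrightarrow> h_s x \<ge> 0"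
  using T_pos by (force simp: mem_S_star dest: bspec[of _ _ 0])

lemma S_bar_safe: "x \<in> S_bar \<Longrightarrow> h_s x \<ge> 0"
  by (force simp: mem_S_bar dest: spec[of _ 0])

lemma closed_superlevel_flow:
  assumes "continuous_on UNIV k" "t \<ge> 0"
  shows "closed {x. 0 \<le> (k (\<phi> x t) :: real)}"
  by (intro closed_Collect_le continuous_on_compose2[OF assms(1)] continuous_on_flow_space assms) auto

lemma closed_S_star: "closed S_star"
proof -
  have "S_star = {x. 0 \<le> h_b (\<phi> x T)} \<inter> (\<Inter>\<tau>\<in>{0..T}. {x. 0 \<le> h_s (\<phi> x \<tau>)})"
    by (auto simp: mem_S_star)
  then show ?thesis
    using T_pos by (auto intro!: closed_Int closed_INT closed_superlevel_flow[OF continuous_h_s]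
        closed_superlevel_flow[OF continuous_h_b])
qed

lemma closed_S_bar: "closed S_bar"
proof -
  have "S_bar = {x. 0 \<le> h_b (\<phi> x T)} \<inter> (\<Inter>i\<in>{..N}. {x. 0 \<le> h_s (\<phi> x (real i * T_s))})"
    by (auto simp: mem_S_bar)
  then show ?thesis
    using T_pos T_s_pos by (auto intro!: closed_Int closed_INT closed_superlevel_flow[OF continuous_h_s]
        closed_superlevel_flow[OF continuous_h_b])
qed

text \<open>At time \<open>T\<close> the flow is in the backup safe set, which is invariant and
  contained in the safe set.\<close>

lemma nonneg_after_T:
  assumes "h_b (\<phi> x T) \<ge> 0" "t \<ge> T"
  shows "h_b (\<phi> x t) \<ge> 0" "h_s (\<phi> x t) \<ge> 0"
proof -
  have "h_b (\<phi> (\<phi> x T) (t - T)) \<ge> 0" by (rule backup_invariant) (use assms in auto)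
  then show "h_b (\<phi> x t) \<ge> 0" using assms T_pos by (simp add: flow_add)
  then show "h_s (\<phi> x t) \<ge> 0" by (rule backup_safe)
qed

text \<open>The shifted window from \<open>t\<close> to \<open>t + T\<close> splits into times
  covered by the original window and times past \<open>T\<close>.\<close>

lemma S_star_invariant:
  assumes x: "x \<in> S_star" and t: "t \<ge> 0"
  shows "\<phi> x t \<in> S_star"
proof -
  have "h_s (\<phi> x (t + \<tau>)) \<ge> 0" if "\<tau> \<ge> 0" for \<tau>
    using x t that nonneg_after_T(2)[of x "t + \<tau>"] by (cases "t + \<tau> \<le> T") (auto simp: mem_S_star)
  moreover have "h_b (\<phi> x (t + T)) \<ge> 0"
    using x t nonneg_after_T(1)[of x "t + T"] by (auto simp: mem_S_star)
  ultimately show ?thesis using t T_pos by (auto simp: mem_S_star flow_add)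
qed

text \<open>A shift by exactly one period maps the sampling grid to itself: sample \<open>i\<close>
  becomes sample \<open>i + 1\<close>, and only the new last one lies past \<open>T\<close>. For a
  general time shift the two grids do not match.\<close>

lemma S_bar_flow_T_s:
  assumes x: "x \<in> S_bar"
  shows "\<phi> x T_s \<in> S_bar"
proof -
  have "h_s (\<phi> x (T_s + real i * T_s)) \<ge> 0" if "i \<le> N" for i
  proof (cases "i = N")
    case True
    with x T_s_pos show ?thesis by (intro nonneg_after_T(2)) (auto simp: mem_S_bar N_T_s)
  next
    case False
    with that have "Suc i \<le> N" by simp
    then have "h_s (\<phi> x (real (Suc i) * T_s)) \<ge> 0" using x unfolding mem_S_bar by blast
    then show ?thesis by (simp add: distrib_right)
  qed
  moreover have "h_b (\<phi> x (T_s + T)) \<ge> 0"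
    by (rule nonneg_after_T(1)) (use x T_s_pos in \<open>auto simp: mem_S_bar\<close>)
  ultimately show ?thesis using T_s_pos T_pos by (auto simp: mem_S_bar flow_add)
qed

section \<open>From the samples to the whole horizon\<close>

(* theta = 1, k = 0 runs forwards from each sampling time, theta = -1, k = 1 backwards from the
   next one. *)
lemma nonneg_near_samples:
  assumes \<theta>: "(\<theta> = 1 \<and> k = 0) \<or> (\<theta> = -1 \<and> k = (1::nat))"
    and x: "h_b (\<phi> x T) \<ge> 0" and samples: "\<And>i. i \<le> N \<Longrightarrow> h_s (\<phi> x (real i * T_s)) > \<epsilon>"
    and lip: "l-lipschitz_on UNIV h_s"
    and speed: "\<And>y. y \<in> S_bar \<Longrightarrow> l * norm (F y) \<le> v"
    and v: "v \<ge> 0" "T_s / 2 * v \<le> \<epsilon>"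
    and r: "r \<in> {0..T_s / 2}" and j: "j < N"
  shows "h_s (\<phi> x (real (j + k) * T_s + \<theta> * r)) > 0"
proof (rule ccontr)
  \<comment> \<open>\<open>c s\<close> is \<open>s\<close> in the forward run and
    \<open>T_s - s\<close> in the backward run. Thus \<open>p i s\<close> lies at time distance
    \<open>s\<close> from sampling time number \<open>i + k\<close>.\<close>
  define c where "c s = real k * T_s + \<theta> * s" for s
  define p where "p i s = \<phi> x (real i * T_s + c s)" for i s
  have c_nonneg: "c s \<ge> 0" if "s \<in> {0..T_s / 2}" for s
    using \<theta> that T_s_pos by (auto simp: c_def)
  have time_nonneg: "real i * T_s + c s \<ge> 0" if "s \<in> {0..T_s / 2}" for i s
    using c_nonneg[OF that] T_s_pos by simp
  have "l \<ge> 0" using lip by (simp add: lipschitz_on_def)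
  have cont: "continuous_on {0..T_s / 2} (p i)" for i
    unfolding p_def
  proof (rule continuous_on_compose2[OF continuous_on_flow_time])
    show "continuous_on {0..T_s / 2} (\<lambda>s. real i * T_s + c s)"
      unfolding c_def by (intro continuous_intros)
  qed (use time_nonneg in auto)
  assume "\<not> h_s (\<phi> x (real (j + k) * T_s + \<theta> * r)) > 0"
  then have bad: "h_s (p j r) \<le> 0" by (simp add: p_def c_def distrib_right add.assoc)
  \<comment> \<open>The bad offset is minimised over all sampling intervals at once, because
    membership of \<open>p i s\<close> in \<open>S_bar\<close> involves the points at offset
    \<open>s\<close> in every later interval.\<close>
  define E where "E = (\<Union>i\<in>{..<N}. {s \<in> {0..T_s / 2}. h_s (p i s) \<le> 0})"
  have "closed E"
    unfolding E_def
    by (intro closed_UN continuous_on_closed_Collect_le continuous_intros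
        continuous_on_compose2[OF continuous_h_s] cont ballI) auto
  moreover have bdd: "bdd_below E" by (auto simp: E_def intro!: bdd_belowI[of _ 0])
  moreover have "E \<noteq> {}" using bad r j by (auto simp: E_def)
  ultimately have "Inf E \<in> E" by (intro closed_contains_Inf)
  then obtain m i where m: "m = Inf E" "m \<in> {0..T_s / 2}" "i < N" "h_s (p i m) \<le> 0"
    by (auto simp: E_def)
  have before: "h_s (p a s) > 0" if "s \<in> {0..<m}" "a < N" for a s
  proof (rule ccontr)
    assume "\<not> h_s (p a s) > 0"
    then have "s \<in> E" using that m(2) by (auto simp: E_def not_less intro!: bexI[of _ a])
    then show False using cInf_lower[OF _ bdd, of s] that m(1) by auto
  qed
  \<comment> \<open>The samples of the flow starting at \<open>p i s\<close> are the points
    \<open>p (i + a) s\<close>: inside the horizon they are positive by minimality of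
    \<open>m\<close>, and the others lie past \<open>T\<close>.\<close>
  have in_S_bar: "p i s \<in> S_bar" if s: "s \<in> {0..<m}" for s
  proof -
    have s': "s \<in> {0..T_s / 2}" using s m by auto
    have eq: "\<phi> (p i s) (real a * T_s) = p (i + a) s" for a
      unfolding p_def using time_nonneg[OF s', of i] T_s_pos
      by (subst flow_add) (auto simp: distrib_right add_ac)
    have "0 \<le> h_s (p (i + a) s)" for a
    proof (cases "i + a < N")
      case True
      then show ?thesis using before[OF s] by (simp add: less_imp_le)
    next
      case False
      then have "real N * T_s \<le> real (i + a) * T_s" using T_s_pos by (intro mult_right_mono) auto
      then have "T \<le> real (i + a) * T_s + c s"
        using c_nonneg[OF s'] N_T_s by linarith
      then show ?thesis unfolding p_def by (rule nonneg_after_T(2)[OF x])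
    qed
    moreover have "0 \<le> h_b (\<phi> (p i s) T)"
    proof -
      have "T \<le> real i * T_s + c s + T" using time_nonneg[OF s', of i] by simp
      moreover have "\<phi> (p i s) T = \<phi> x (real i * T_s + c s + T)"
        unfolding p_def using time_nonneg[OF s', of i] T_pos by (intro flow_add) auto
      ultimately show ?thesis using nonneg_after_T[OF x] by simp
    qed
    ultimately show ?thesis by (simp add: mem_S_bar eq)
  qed
  \<comment> \<open>Mean value inequality for the path scaled by \<open>l\<close>. The scaling is
    kept because \<open>v\<close> bounds \<open>l\<close> times the speed; for \<open>l = 0\<close>
    the speed itself may be unbounded.\<close>
  have "l * dist (p i m) (p i 0) \<le> v * m"
  proof (cases "m = 0")
    case False
    then have "m > 0" using m by auto
    have "norm (l *\<^sub>R p i m - l *\<^sub>R p i 0) \<le> v * m - v * 0"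
    proof (rule differentiable_bound_general[OF \<open>m > 0\<close>])
      show "continuous_on {0..m} (\<lambda>s. l *\<^sub>R p i s)"
        using m by (intro continuous_intros continuous_on_subset[OF cont]) auto
      fix s assume s: "0 < s" "s < m"
      let ?t = "real i * T_s + c s"
      have "c s > 0" using \<theta> s m T_s_pos by (auto simp: c_def)
      then have "?t > 0" using T_s_pos by (simp add: add_nonneg_pos)
      then have "(\<phi> x has_vector_derivative F (\<phi> x ?t)) (at ?t)"
        using flow_has_vector_derivative[of ?t x] at_within_interior[of ?t "{0..}"] by simp
      moreover have "((\<lambda>s. real i * T_s + c s) has_vector_derivative \<theta>) (at s)"
        unfolding c_def by (auto intro!: derivative_eq_intros)
      ultimately have "(p i has_vector_derivative \<theta> *\<^sub>R F (p i s)) (at s)"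
        unfolding p_def using vector_diff_chain_at[of "\<lambda>s. real i * T_s + c s" \<theta> s "\<phi> x"]
        by (simp add: o_def)
      then show "((\<lambda>s. l *\<^sub>R p i s) has_vector_derivative l *\<^sub>R \<theta> *\<^sub>R F (p i s)) (at s)"
        by (auto intro!: derivative_eq_intros)
      show "((\<lambda>s. v * s) has_vector_derivative v) (at s)"
        by (auto intro!: derivative_eq_intros)
      show "norm (l *\<^sub>R \<theta> *\<^sub>R F (p i s)) \<le> v"
        using speed[OF in_S_bar, of s] s \<theta> \<open>l \<ge> 0\<close> by auto
    qed (auto intro!: continuous_intros)
    then show ?thesis using \<open>l \<ge> 0\<close> by (simp add: dist_norm flip: scaleR_diff_right)
  qed simp
  moreover have "\<bar>h_s (p i m) - h_s (p i 0)\<bar> \<le> l * dist (p i m) (p i 0)"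
    using lipschitz_onD[OF lip] by (simp add: dist_real_def)
  \<comment> \<open>Offset 0 is the sample \<open>i + k\<close>, whose index is at most
    \<open>N\<close> since \<open>i < N\<close>. As \<open>m\<close> is at most half a period, the
    total drop \<open>v * m\<close> is at most \<epsilon>, so \<open>h_s\<close> is still positive
    at \<open>p i m\<close>.\<close>
  moreover have "h_s (p i 0) > \<epsilon>"
    using samples[of "i + k"] m \<theta> by (auto simp: p_def c_def distrib_right)
  moreover have "v * m \<le> \<epsilon>"
    using mult_left_mono[of m "T_s / 2" v] m v by (simp add: algebra_simps)
  ultimately show False using m by linarith
qed

text \<open>Round \<open>t\<close> down to a sampling time; go forwards from it if it is at most
  half a period away, and otherwise backwards from the next one. The unsimplified \<open>+ 0\<close>
  and \<open>1 *\<close> match the two instances of \<open>nonneg_near_samples\<close>.\<close>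

lemma near_sample_time:
  assumes "t \<in> {0..<T}"
  obtains j r where "j < N" "r \<in> {0..T_s / 2}"
    "t = real (j + 0) * T_s + 1 * r \<or> t = real (j + 1) * T_s + (- 1) * r"
proof -
  define j where "j = nat \<lfloor>t / T_s\<rfloor>"
  have j: "real j \<le> t / T_s" "t / T_s < real j + 1"
    using assms T_s_pos by (auto simp: j_def)
  have "real j * T_s \<le> t" using j T_s_pos by (simp add: field_simps)
  have "t < real (j + 1) * T_s" using j T_s_pos by (simp add: field_simps)
  have "real j * T_s < real N * T_s" using \<open>real j * T_s \<le> t\<close> assms N_T_s by auto
  then have "j < N" using T_s_pos by simp
  show thesis
  proof (cases "t - real j * T_s \<le> T_s / 2")
    case True
    with \<open>j < N\<close> \<open>real j * T_s \<le> t\<close> show ?thesis by (intro that[of j "t - real j * T_s"]) auto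
  next
    case False
    with \<open>j < N\<close> \<open>t < real (j + 1) * T_s\<close> show ?thesis
      by (intro that[of j "real (j + 1) * T_s - t"]) (auto simp: algebra_simps)
  qed
qed

text \<open>Turns the extended-real hypothesis into a real bound. An infinite speed contradicts it
  when \<open>l > 0\<close>; when \<open>l = 0\<close> the product is 0, so \<open>v = 0\<close>
  works even for infinite speed. The point \<open>x\<close> rules out the empty supremum, which
  would be minus infinity.\<close>

lemma speed_bound:
  assumes le: "ereal (1/2 * T_s) * max_speed F S_bar * ereal l \<le> ereal \<epsilon>" and "l \<ge> 0" "x \<in> S_bar"
  obtains v where "v \<ge> 0" "T_s / 2 * v \<le> \<epsilon>" "\<And>y. y \<in> S_bar \<Longrightarrow> l * norm (F y) \<le> v"
proof (cases "l = 0")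
  case True
  then show ?thesis using that[of 0] le by (simp add: zero_ereal_def[symmetric])
next
  case False
  then have "l > 0" using \<open>l \<ge> 0\<close> by simp
  have sp: "ereal (norm (F y)) \<le> max_speed F S_bar" if "y \<in> S_bar" for y
    unfolding max_speed_def using that by (rule SUP_upper)
  obtain w where w: "max_speed F S_bar = ereal w"
  proof (cases "max_speed F S_bar")
    case PInf
    with le \<open>l > 0\<close> T_s_pos show ?thesis by simp
  next
    case MInf
    with sp[OF \<open>x \<in> S_bar\<close>] show ?thesis by simp
  qed
  show ?thesis
  proof (rule that[of "l * w"])
    show "T_s / 2 * (l * w) \<le> \<epsilon>" using le by (simp add: w ac_simps)
    show "l * norm (F y) \<le> l * w" if "y \<in> S_bar" for y
      using sp[OF that] \<open>l > 0\<close> by (simp add: w)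
    have "0 \<le> w" using sp[OF \<open>x \<in> S_bar\<close>] norm_ge_zero[of "F x"] unfolding w by (simp del: norm_ge_zero)
    then show "l * w \<ge> 0" using \<open>l > 0\<close> by simp
  qed
qed

lemma samples_imp_S_star:
  assumes "\<epsilon> \<ge> 0" and hb: "h_b (\<phi> x T) \<ge> 0"
    and samples: "\<And>i. i \<le> N \<Longrightarrow> h_s (\<phi> x (real i * T_s)) > \<epsilon>"
    and lip: "l-lipschitz_on UNIV h_s"
    and le: "ereal (1/2 * T_s) * max_speed F S_bar * ereal l \<le> ereal \<epsilon>"
  shows "x \<in> S_star"
proof -
  have "x \<in> S_bar" using assms by (force simp: mem_S_bar)
  moreover have "l \<ge> 0" using lip by (simp add: lipschitz_on_def)
  ultimately obtain v where v: "v \<ge> 0" "T_s / 2 * v \<le> \<epsilon>" "\<And>y. y \<in> S_bar \<Longrightarrow> l * norm (F y) \<le> v"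
    using speed_bound[OF le] by blast
  have "h_s (\<phi> x t) \<ge> 0" if "t \<in> {0..T}" for t
  \<comment> \<open>The endpoint starts no sampling interval; there the terminal condition on
    \<open>h_b\<close> gives safety.\<close>
  proof (cases "t = T")
    case True
    then show ?thesis using backup_safe[OF hb] by simp
  next
    case False
    with that have "t \<in> {0..<T}" by auto
    then obtain j r where j: "j < N" "r \<in> {0..T_s / 2}"
      "t = real (j + 0) * T_s + 1 * r \<or> t = real (j + 1) * T_s + (- 1) * r"
      by (rule near_sample_time)
    have "h_s (\<phi> x (real (j + k) * T_s + \<theta> * r)) > 0"
      if "(\<theta> = 1 \<and> k = 0) \<or> (\<theta> = - 1 \<and> k = 1)" for \<theta> k
      by (rule nonneg_near_samples[OF that hb samples lip v(3,1,2) j(2,1)])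
    from this[of 1 0] this[of "- 1" 1] have "h_s (\<phi> x (real (j + 0) * T_s + 1 * r)) > 0"
      "h_s (\<phi> x (real (j + 1) * T_s + (- 1) * r)) > 0" by blast+
    with j(3) show ?thesis by (metis less_imp_le)
  qed
  then show ?thesis using hb by (simp add: mem_S_star)
qed

end

section \<open>Trajectories that follow the backup field where the barrier is small\<close>

locale switched_backup = backup_flow F \<phi> h_s h_b T N
  for F :: "real^'n \<Rightarrow> real^'n" and \<phi> h_s h_b T N +
  fixes h :: "real^'n \<Rightarrow> real" and \<epsilon> :: real and G :: "real^'n \<Rightarrow> real^'n" and z :: "real \<Rightarrow> real^'n"
  assumes continuous_h: "continuous_on UNIV h"
    and h_less_samples: "\<And>x i. i \<le> N \<Longrightarrow> h x < h_s (\<phi> x (real i * T_s))"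
    and h_less_terminal: "\<And>x. h x < h_b (\<phi> x T)"
    and \<epsilon>_nonneg: "\<epsilon> \<ge> 0"
    and G_eq_F: "\<And>x. h x \<le> \<epsilon> \<Longrightarrow> G x = F x"
    and solution: "\<And>t. t \<ge> 0 \<Longrightarrow> (z has_vector_derivative G (z t)) (at t within {0..})"
begin

lemma h_nonneg_imp_S_bar: "h x \<ge> 0 \<Longrightarrow> x \<in> S_bar"
  using h_less_samples[of _ x] h_less_terminal[of x] by (force simp: mem_S_bar)

lemma continuous_on_solution: "continuous_on {0..} z"
  using solution has_vector_derivative_continuous
  unfolding continuous_on_eq_continuous_within by (metis atLeast_iff)

text \<open>Nothing is known of \<open>G\<close> where \<open>h\<close> exceeds \<epsilon>, so its
  solutions may be nonunique; below \<epsilon> it agrees with the Lipschitz field \<open>F\<close>,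
  and uniqueness for \<open>F\<close> decides. The start time is left out of the hypothesis because
  the applications control \<open>h\<close> only after it; continuity of \<open>h\<close> along
  \<open>z\<close> recovers it.\<close>

lemma follows_backup_flow:
  assumes "t \<ge> 0" "\<tau> > 0" and below: "\<And>s. s \<in> {t<..t + \<tau>} \<Longrightarrow> h (z s) \<le> \<epsilon>"
  shows "z (t + \<tau>) = \<phi> (z t) \<tau>"
proof -
  have le: "h (z (t + s)) \<le> \<epsilon>" if "s \<in> {0..\<tau>}" for s
  proof (rule continuous_le_on_closure[where S = "{0<..\<tau>}" and f = "\<lambda>s. h (z (t + s))"])
    show "continuous_on (closure {0<..\<tau>}) (\<lambda>s. h (z (t + s)))"
      using assms by (intro continuous_on_compose2[OF continuous_h]
          continuous_on_compose2[OF continuous_on_solution] continuous_intros) auto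
  qed (use that below \<open>\<tau> > 0\<close> in auto)
  have "((\<lambda>s. z (t + s)) has_vector_derivative F (z (t + s))) (at s within {0..\<tau>})"
    if "s \<in> {0..\<tau>}" for s
    unfolding G_eq_F[OF le[OF that], symmetric]
    by (rule has_vector_derivative_within_subset[OF shifted_solution[of z G, OF solution]])
      (use that assms in auto)
  from flow_unique[OF this, of \<tau>] assms show ?thesis by simp
qed

lemma returns_to_S_bar:
  assumes "t \<ge> 0" "z t \<in> S_bar"
  shows "\<exists>\<tau>\<in>{0<..T_s}. z (t + \<tau>) \<in> S_bar"
proof (rule ccontr)
  assume contra: "\<not> ?thesis"
  \<comment> \<open>Staying outside \<open>S_bar\<close> forces \<open>h\<close> to be negative
    along the whole period, which makes the trajectory a backup trajectory.\<close>
  have "h (z s) \<le> \<epsilon>" if "s \<in> {t<..t + T_s}" for s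
    using contra h_nonneg_imp_S_bar[of "z s"] that \<epsilon>_nonneg by (force dest: bspec[of _ _ "s - t"])
  then have "z (t + T_s) = \<phi> (z t) T_s"
    using assms T_s_pos by (intro follows_backup_flow)
  with S_bar_flow_T_s[OF assms(2)] have "z (t + T_s) \<in> S_bar" by simp
  moreover have "T_s \<in> {0<..T_s}" using T_s_pos by simp
  ultimately show False using contra by blast
qed

text \<open>Consider the last time \<open>s\<close> before \<open>t\<close> in the closed set
  \<open>S_star\<close>. After \<open>s\<close> the barrier is at most \<epsilon>, since a larger
  value would mean membership, so the trajectory follows the backup flow from a point of an
  invariant set.\<close>

lemma stays_in_S_star:
  assumes lip: "l-lipschitz_on UNIV h_s"
    and le: "ereal (1/2 * T_s) * max_speed F S_bar * ereal l \<le> ereal \<epsilon>"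
    and z0: "z 0 \<in> S_star" and t: "t \<ge> 0"
  shows "z t \<in> S_star"
proof (rule ccontr)
  assume out: "z t \<notin> S_star"
  define E where "E = {s \<in> {0..t}. z s \<in> S_star}"
  have "closed ({0..t} \<inter> z -` S_star)"
    by (intro continuous_closed_preimage continuous_on_subset[OF continuous_on_solution]
        closed_S_star) auto
  then have "closed E" by (simp add: E_def vimage_def Int_def)
  moreover have bdd: "bdd_above E" by (auto simp: E_def intro!: bdd_aboveI[of _ t])
  moreover have "E \<noteq> {}" using z0 t by (auto simp: E_def)
  ultimately have "Sup E \<in> E" by (intro closed_contains_Sup)
  define s where "s = Sup E"
  have s: "s \<ge> 0" "s \<le> t" "z s \<in> S_star" using \<open>Sup E \<in> E\<close> by (auto simp: E_def s_def)
  then have "s < t" using out by (cases "s = t") auto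
  have "h (z r) \<le> \<epsilon>" if r: "r \<in> {s<..s + (t - s)}" for r
  proof (rule ccontr)
    assume "\<not> h (z r) \<le> \<epsilon>"
    then have "z r \<in> S_star"
      using h_less_samples[of _ "z r"] h_less_terminal[of "z r"] \<epsilon>_nonneg
      by (intro samples_imp_S_star[OF \<epsilon>_nonneg _ _ lip le]) force+
    then have "r \<in> E" using r s by (auto simp: E_def)
    then show False using cSup_upper[OF _ bdd, of r] r by (auto simp: s_def)
  qed
  then have "z (s + (t - s)) = \<phi> (z s) (t - s)"
    using s \<open>s < t\<close> by (intro follows_backup_flow) auto
  with S_star_invariant[OF s(3), of "t - s"] \<open>s < t\<close> out show False by simp
qed

end

section \<open>The quadratic program\<close>

lemma closed_admissible: "closed (admissible A b)"
proof -
  have "admissible A b = (\<Inter>i. {u. (A *v u) $ i \<le> b $ i})" by (auto simp: admissible_def)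
  moreover have "closed {u. (A *v u) $ i \<le> b $ i}" for i
    by (intro closed_Collect_le continuous_intros
        bounded_linear.continuous_on[OF matrix_vector_mul_bounded_linear])
  ultimately show ?thesis by auto
qed

lemma convex_admissible: "convex (admissible A b)"
proof (rule convexI)
  fix v w and s t :: real
  assume vw: "v \<in> admissible A b" "w \<in> admissible A b" and st: "s \<ge> 0" "t \<ge> 0" "s + t = 1"
  have "s * (A *v v) $ i + t * (A *v w) $ i \<le> b $ i" for i
    using vw st by (intro convex_bound_le) (auto simp: admissible_def)
  then show "s *\<^sub>R v + t *\<^sub>R w \<in> admissible A b"
    by (simp add: admissible_def matrix_vector_right_distrib matrix_vector_mult_scaleR)
qed

lemma C1_continuous_on_grad:
  assumes "C1 h"
  shows "continuous_on UNIV (grad h)"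
proof -
  obtain h' where der: "\<And>x. (h has_derivative blinfun_apply (h' x)) (at x)"
    and cont: "continuous_on UNIV h'"
    using assms unfolding C1_def by blast
  \<comment> \<open>Uniqueness of the derivative identifies the chosen
    \<open>frechet_derivative\<close> with \<open>h' x\<close>.\<close>
  have "grad h x = (\<chi> i. blinfun_apply (h' x) (axis i 1))" for x
    using frechet_derivative_at[OF der[of x]] by (simp add: grad_def)
  then have "grad h = (\<lambda>x. \<chi> i. blinfun_apply (h' x) (axis i 1))" by auto
  then show ?thesis by (auto intro!: continuous_intros cont)
qed

lemma continuous_on_vector_matrix_mult:
  fixes G :: "'a::topological_space \<Rightarrow> real^'m^'n"
  assumes "continuous_on X k" "continuous_on X G"
  shows "continuous_on X (\<lambda>x. k x v* G x)"
  unfolding vector_matrix_mult_def using assms by (intro continuous_intros)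

section \<open>Support functions, projections and their dependence on parameters\<close>

lemma
  fixes U :: "'a::euclidean_space set"
  assumes "compact U" "U \<noteq> {}"
  shows support_function_upper: "v \<in> U \<Longrightarrow> c \<bullet> v \<le> (SUP v\<in>U. c \<bullet> v)"
    and support_function_attained: "\<exists>v\<in>U. c \<bullet> v = (SUP v\<in>U. c \<bullet> v)"
proof -
  have cont: "continuous_on U (\<lambda>v. c \<bullet> v)" by (intro continuous_intros)
  then have "bdd_above ((\<lambda>v. c \<bullet> v) ` U)"
    using assms(1) by (intro bounded_imp_bdd_above compact_imp_bounded compact_continuous_image)
  then show "c \<bullet> v \<le> (SUP v\<in>U. c \<bullet> v)" if "v \<in> U" for v
    using that by (intro cSUP_upper)
  obtain w where w: "w \<in> U" "\<forall>v\<in>U. c \<bullet> v \<le> c \<bullet> w"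
    using continuous_attains_sup[OF assms cont] by blast
  then have "(SUP v\<in>U. c \<bullet> v) = c \<bullet> w"
    by (intro cSup_eq_maximum) auto
  with w show "\<exists>v\<in>U. c \<bullet> v = (SUP v\<in>U. c \<bullet> v)" by metis
qed

text \<open>A maximiser for \<open>c\<close> is a competitor for \<open>d\<close>, so a bound on the
  norms in \<open>U\<close> is a Lipschitz constant.\<close>

lemma continuous_on_support_function:
  fixes U :: "'a::euclidean_space set"
  assumes "compact U" "U \<noteq> {}"
  shows "continuous_on UNIV (\<lambda>c. SUP v\<in>U. c \<bullet> v)"
proof -
  obtain B where B: "\<And>v. v \<in> U \<Longrightarrow> norm v \<le> B" and "B > 0"
    using compact_imp_bounded[OF assms(1)] by (auto simp: bounded_pos)
  have le: "(SUP v\<in>U. c \<bullet> v) \<le> (SUP v\<in>U. d \<bullet> v) + B * dist c d" for c d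
  proof -
    obtain v where v: "v \<in> U" "c \<bullet> v = (SUP v\<in>U. c \<bullet> v)"
      using support_function_attained[OF assms] by blast
    have "c \<bullet> v = d \<bullet> v + (c - d) \<bullet> v" by (simp add: inner_diff_left)
    also have "(c - d) \<bullet> v \<le> norm (c - d) * B"
      using B[OF v(1)] norm_cauchy_schwarz[of "c - d" v] mult_left_mono[of "norm v" B "norm (c - d)"]
      by simp
    finally show ?thesis
      using v support_function_upper[OF assms v(1), of d] by (simp add: dist_norm mult.commute)
  qed
  have "B-lipschitz_on UNIV (\<lambda>c. SUP v\<in>U. c \<bullet> v)"
  proof (rule lipschitz_onI)
    fix c d
    show "dist (SUP v\<in>U. c \<bullet> v) (SUP v\<in>U. d \<bullet> v) \<le> B * dist c d"
      using le[of c d] le[of d c] by (simp add: dist_real_def dist_commute abs_le_iff)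
  qed (use \<open>B > 0\<close> in simp)
  then show ?thesis by (rule lipschitz_on_continuous_on)
qed

text \<open>\<open>arg_min\<close> chooses some minimiser; projections onto a nonempty closed convex
  set are unique, so the choice is determined.\<close>

lemma arg_min_norm_eq_closest_point:
  fixes K :: "'a::euclidean_space set"
  assumes "closed K" "convex K" "K \<noteq> {}"
  shows "arg_min (\<lambda>v. (norm (v - d))\<^sup>2) (\<lambda>v. v \<in> K) = closest_point K d"
proof (rule arg_minI[where Q = "\<lambda>k. k = closest_point K d"])
  show "closest_point K d \<in> K" using assms by (simp add: closest_point_in_set)
  show "\<not> (norm (v - d))\<^sup>2 < (norm (closest_point K d - d))\<^sup>2" if "v \<in> K" for v
    using closest_point_le[OF assms(1) that, of d] by (simp add: dist_norm norm_minus_commute not_less)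
  fix k assume "k \<in> K" and min: "\<forall>v. v \<in> K \<longrightarrow> \<not> (norm (v - d))\<^sup>2 < (norm (k - d))\<^sup>2"
  have "\<forall>v\<in>K. dist d k \<le> dist d v"
    using min by (auto simp: dist_norm norm_minus_commute not_less)
  then show "k = closest_point K d"
    using assms \<open>k \<in> K\<close> by (intro closest_point_unique)
qed

text \<open>Otherwise some subsequence keeps a positive distance from \<open>q\<close>, yet by
  compactness it has a convergent subsequence, whose limit must be \<open>q\<close>.\<close>

lemma tendsto_compact_unique_limit_point:
  fixes p :: "nat \<Rightarrow> 'a::metric_space"
  assumes "compact U" "\<And>n. p n \<in> U"
    and limit: "\<And>r l. strict_mono r \<Longrightarrow> (p \<circ> r) \<longlonglongrightarrow> l \<Longrightarrow> l = q"
  shows "p \<longlonglongrightarrow> q"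
proof (rule ccontr)
  assume "\<not> p \<longlonglongrightarrow> q"
  then obtain e where "e > 0" and far: "\<exists>\<^sub>F n in sequentially. dist (p n) q \<ge> e"
    unfolding tendsto_iff frequently_def by (auto simp: not_le)
  then have "infinite {n. dist (p n) q \<ge> e}"
    by (simp add: frequently_cofinite flip: cofinite_eq_sequentially)
  then obtain r :: "nat \<Rightarrow> nat" where r: "strict_mono r" "\<And>n. dist (p (r n)) q \<ge> e"
    using infinite_enumerate by blast
  obtain l s where "strict_mono s" and l: "(p \<circ> r \<circ> s) \<longlonglongrightarrow> l"
    using assms(1,2) unfolding compact_def by (metis comp_apply)
  then have "l = q" using limit[of "r \<circ> s" l] r(1) by (simp add: strict_mono_o o_assoc)
  then have "\<forall>\<^sub>F n in sequentially. dist ((p \<circ> r \<circ> s) n) q < e"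
    using tendstoD[OF l \<open>e > 0\<close>] by simp
  then show False using r(2) by (auto simp: eventually_sequentially not_less[symmetric])
qed

(* Slater's condition lets an arbitrary competitor w be perturbed to a strictly feasible point,
   which stays feasible for nearby parameters. *)
lemma tendsto_closest_point_halfspace:
  fixes U :: "'a::euclidean_space set" and c :: "nat \<Rightarrow> 'a"
  defines "K \<equiv> (\<lambda>a c. {v \<in> U. a + c \<bullet> v \<ge> (0::real)})"
  assumes "compact U" "convex U"
    and a: "a \<longlonglongrightarrow> a0" and c: "c \<longlonglongrightarrow> c0" and d: "d \<longlonglongrightarrow> d0"
    and feasible: "\<And>n. K (a n) (c n) \<noteq> {}"
    and slater: "v0 \<in> U" "a0 + c0 \<bullet> v0 > 0"
  shows "(\<lambda>n. closest_point (K (a n) (c n)) (d n)) \<longlonglongrightarrow> closest_point (K a0 c0) d0"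
proof (rule tendsto_compact_unique_limit_point[OF \<open>compact U\<close>])
  have closed: "closed (K a c)" for a c
  proof -
    have "K a c = U \<inter> {v. 0 \<le> a + c \<bullet> v}" by (auto simp: K_def)
    moreover have "closed {v. 0 \<le> a + c \<bullet> v}" by (intro closed_Collect_le continuous_intros)
    ultimately show ?thesis using \<open>compact U\<close> by (simp add: compact_imp_closed closed_Int)
  qed
  have convex: "convex (K a0 c0)"
  proof -
    have "K a0 c0 = U \<inter> {v. c0 \<bullet> v \<ge> - a0}" by (auto simp: K_def)
    then show ?thesis using \<open>convex U\<close> by (simp add: convex_Int convex_halfspace_ge)
  qed
  have in_K: "closest_point (K (a n) (c n)) (d n) \<in> K (a n) (c n)" for n
    using closed feasible by (rule closest_point_in_set)
  then show "closest_point (K (a n) (c n)) (d n) \<in> U" for n by (auto simp: K_def)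
  fix r :: "nat \<Rightarrow> nat" and l
  assume r: "strict_mono r" and "((\<lambda>n. closest_point (K (a n) (c n)) (d n)) \<circ> r) \<longlonglongrightarrow> l"
  then have l: "(\<lambda>n. closest_point (K (a (r n)) (c (r n))) (d (r n))) \<longlonglongrightarrow> l" (is "?p \<longlonglongrightarrow> l")
    by (simp add: o_def)
  have ar: "(\<lambda>n. a (r n)) \<longlonglongrightarrow> a0" and cr: "(\<lambda>n. c (r n)) \<longlonglongrightarrow> c0" and dr: "(\<lambda>n. d (r n)) \<longlonglongrightarrow> d0"
    using LIMSEQ_subseq_LIMSEQ[OF a r] LIMSEQ_subseq_LIMSEQ[OF c r] LIMSEQ_subseq_LIMSEQ[OF d r]
    by (simp_all add: o_def)
  show "l = closest_point (K a0 c0) d0"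
  proof (rule closest_point_unique[OF convex closed])
    have "l \<in> U"
      using compact_imp_closed[OF \<open>compact U\<close>] l in_K
      by (elim closed_sequentially) (auto simp: K_def)
    moreover have "(\<lambda>n. a (r n) + c (r n) \<bullet> ?p n) \<longlonglongrightarrow> a0 + c0 \<bullet> l"
      by (intro tendsto_intros ar cr l)
    then have "0 \<le> a0 + c0 \<bullet> l"
      by (rule LIMSEQ_le_const) (use in_K in \<open>auto simp: K_def\<close>)
    ultimately show "l \<in> K a0 c0" by (simp add: K_def)
    show "\<forall>w\<in>K a0 c0. dist d0 l \<le> dist d0 w"
    proof
      fix w assume w: "w \<in> K a0 c0"
      \<comment> \<open>The segment from \<open>w\<close> to the Slater point: for \<open>s\<close>
        strictly between 0 and 1 the constraint at \<open>ws s\<close> is strict in the limit, hence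
        satisfied for all large \<open>n\<close>, where the projection is at least as close as
        \<open>ws s\<close>.\<close>
      define ws where "ws s = (1 - s) *\<^sub>R w + s *\<^sub>R v0" for s
      have le: "dist d0 l \<le> dist d0 (ws s)" if s: "0 < s" "s < 1" for s
      proof (rule LIMSEQ_le)
        have wsU: "ws s \<in> U"
          using w slater(1) \<open>convex U\<close> s unfolding ws_def K_def
          by (intro convexD_alt) auto
        have "a0 + c0 \<bullet> ws s = (1 - s) * (a0 + c0 \<bullet> w) + s * (a0 + c0 \<bullet> v0)"
          by (simp add: ws_def inner_add_right algebra_simps)
        moreover have "\<dots> > 0"
          using w s slater(2) by (intro add_nonneg_pos[OF mult_nonneg_nonneg mult_pos_pos]) (auto simp: K_def)
        ultimately have pos: "a0 + c0 \<bullet> ws s > 0" by simp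
        have "(\<lambda>n. a (r n) + c (r n) \<bullet> ws s) \<longlonglongrightarrow> a0 + c0 \<bullet> ws s"
          by (intro tendsto_intros ar cr)
        from order_tendstoD(1)[OF this pos]
        have "\<forall>\<^sub>F n in sequentially. dist (d (r n)) (?p n) \<le> dist (d (r n)) (ws s)"
          by (rule eventually_mono) (use wsU closed in \<open>auto intro!: closest_point_le simp: K_def\<close>)
        then show "\<exists>M. \<forall>n\<ge>M. dist (d (r n)) (?p n) \<le> dist (d (r n)) (ws s)"
          by (simp add: eventually_sequentially)
      qed (intro tendsto_intros dr l)+
      \<comment> \<open>Letting \<open>s\<close> tend to 0 replaces \<open>ws s\<close> by the
        competitor \<open>w\<close>.\<close>
      have "((\<lambda>s. dist d0 (ws s)) \<longlongrightarrow> dist d0 (ws 0)) (at_right 0)"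
        unfolding ws_def by (intro tendsto_intros)
      moreover have "\<forall>\<^sub>F s in at_right 0. dist d0 l \<le> dist d0 (ws s)"
        unfolding eventually_at_right_field using le by (intro exI[of _ 1]) auto
      ultimately have "dist d0 l \<le> dist d0 (ws 0)"
        by (rule tendsto_lowerbound) simp
      then show "dist d0 l \<le> dist d0 w" by (simp add: ws_def)
    qed
  qed
qed

text \<open>A squeeze that asks for no continuity of \<open>w\<close>.\<close>

lemma continuous_scaled_bounded:
  fixes w :: "'a::t2_space \<Rightarrow> 'b::real_normed_vector"
  assumes "isCont s x" "s x = (0::real)" "\<And>y. norm (w y) \<le> B"
  shows "isCont (\<lambda>y. s y *\<^sub>R w y) x"
proof -
  have "(s \<longlongrightarrow> 0) (at x)" using assms(1,2) by (simp add: isCont_def)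
  then have "((\<lambda>y. \<bar>s y\<bar> * B) \<longlongrightarrow> 0) (at x)"
    by (intro tendsto_mult_left_zero tendsto_rabs_zero)
  moreover have "\<forall>\<^sub>F y in at x. norm (s y *\<^sub>R w y) \<le> \<bar>s y\<bar> * B"
    using assms(3) by (auto intro!: mult_left_mono always_eventually)
  ultimately have "((\<lambda>y. s y *\<^sub>R w y) \<longlongrightarrow> 0) (at x)" by (rule Lim_null_comparison[rotated])
  then show ?thesis using assms(2) by (simp add: isCont_def)
qed

section \<open>Continuity and admissibility of the blended feedback\<close>

locale barrier_qp =
  fixes f :: "real^'n \<Rightarrow> real^'n" and g :: "real^'n \<Rightarrow> real^'m^'n" and U :: "(real^'m) set"
    and h :: "real^'n \<Rightarrow> real" and \<alpha> \<epsilon> :: real and u_d :: "real^'n \<Rightarrow> real^'m"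
  assumes C1_f: "C1 f" and C1_g: "C1 g" and C1_h: "C1 h"
    and compact_U: "compact U" and convex_U: "convex U" and U_nonempty: "U \<noteq> {}"
begin

text \<open>The part of the constraint that does not depend on the control; \<beta> is this plus the
  support function of \<open>U\<close> at \<open>Lie_g g h x\<close>.\<close>

definition drift :: "real^'n \<Rightarrow> real" where
  "drift x = Lie_f f h x + \<alpha> * (h x - \<epsilon>)"

definition feasible :: "real^'n \<Rightarrow> (real^'m) set" where
  "feasible x = {v \<in> U. drift x + Lie_g g h x \<bullet> v \<ge> 0}"

abbreviation "\<gamma> \<equiv> gamma f g U h \<alpha> \<epsilon>"
abbreviation "u_star \<equiv> qp_control f g U h \<alpha> \<epsilon> u_d"

lemma beta_eq: "beta f g U h \<alpha> \<epsilon> x = drift x + (SUP v\<in>U. Lie_g g h x \<bullet> v)"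
  by (simp add: beta_def drift_def)

lemma continuous_on_drift: "continuous_on X drift"
  unfolding drift_def Lie_f_def
  by (intro continuous_intros C1_imp_continuous_on C1_f C1_h
      continuous_on_subset[OF C1_continuous_on_grad[OF C1_h]]) auto

lemma continuous_on_Lie_g: "continuous_on X (Lie_g g h)"
  unfolding Lie_g_def
  by (intro continuous_on_vector_matrix_mult C1_imp_continuous_on C1_g
      continuous_on_subset[OF C1_continuous_on_grad[OF C1_h]]) auto

lemma continuous_on_gamma: "continuous_on X \<gamma>"
  unfolding gamma_def beta_eq
  by (intro continuous_intros C1_imp_continuous_on C1_h continuous_on_drift continuous_on_Lie_g
      continuous_on_compose2[OF continuous_on_support_function[OF compact_U U_nonempty]]) auto

text \<open>A maximiser of the linear term gives the constraint the value \<beta>, which is at least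
  \<gamma>. Hence nonnegative \<gamma> yields feasibility and positive \<gamma> yields Slater's
  condition.\<close>

lemma slater_point:
  obtains v where "v \<in> U" "drift x + Lie_g g h x \<bullet> v \<ge> \<gamma> x"
  using support_function_attained[OF compact_U U_nonempty, of "Lie_g g h x"]
  by (force simp: gamma_def beta_eq)

lemma feasible_nonempty:
  assumes "\<gamma> x \<ge> 0"
  shows "feasible x \<noteq> {}"
proof -
  obtain v where "v \<in> U" "drift x + Lie_g g h x \<bullet> v \<ge> \<gamma> x" by (rule slater_point)
  with assms have "v \<in> feasible x" by (simp add: feasible_def)
  then show ?thesis by blast
qed

lemma feasible_eq_Int: "feasible x = U \<inter> {v. Lie_g g h x \<bullet> v \<ge> - drift x}"
  by (auto simp: feasible_def)

lemma u_star_eq: "\<gamma> x \<ge> 0 \<Longrightarrow> u_star x = closest_point (feasible x) (u_d x)"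
  and u_star_in_U: "\<gamma> x \<ge> 0 \<Longrightarrow> u_star x \<in> U"
proof -
  assume "\<gamma> x \<ge> 0"
  have closed: "closed (feasible x)" and "convex (feasible x)"
    unfolding feasible_eq_Int using compact_U convex_U
    by (auto intro!: closed_Int convex_Int closed_halfspace_ge convex_halfspace_ge compact_imp_closed)
  moreover note nonempty = feasible_nonempty[OF \<open>\<gamma> x \<ge> 0\<close>]
  moreover have "u_star x = arg_min (\<lambda>v. (norm (v - u_d x))\<^sup>2) (\<lambda>v. v \<in> feasible x)"
    by (simp add: qp_control_def feasible_def drift_def add_ac)
  ultimately show eq: "u_star x = closest_point (feasible x) (u_d x)"
    by (simp add: arg_min_norm_eq_closest_point)
  show "u_star x \<in> U"
    using closest_point_in_set[OF closed nonempty, of "u_d x"]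
    unfolding eq by (simp add: feasible_eq_Int)
qed

lemma isCont_u_star:
  assumes u_d: "isCont u_d x" and "\<gamma> x > 0"
  shows "isCont u_star x"
proof -
  have cont: "isCont \<gamma> x" "isCont drift x" "isCont (Lie_g g h) x"
    using continuous_on_gamma[of UNIV] continuous_on_drift[of UNIV] continuous_on_Lie_g[of UNIV]
    by (simp_all add: continuous_on_eq_continuous_at)
  obtain v0 where v0: "v0 \<in> U" "drift x + Lie_g g h x \<bullet> v0 > 0"
    by (rule slater_point[of x]) (use \<open>\<gamma> x > 0\<close> in force)
  show ?thesis
    unfolding continuous_at_sequentially o_def
  proof (intro allI impI)
    fix y assume y: "y \<longlonglongrightarrow> x"
    have "(\<lambda>n. \<gamma> (y n)) \<longlonglongrightarrow> \<gamma> x" using cont(1) y by (rule isCont_tendsto_compose)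
    then have "\<forall>\<^sub>F n in sequentially. \<gamma> (y n) > 0" using \<open>\<gamma> x > 0\<close> by (rule order_tendstoD)
    then obtain M where M: "\<And>n. n \<ge> M \<Longrightarrow> \<gamma> (y n) > 0" by (auto simp: eventually_sequentially)
    \<comment> \<open>Dropping finitely many terms makes every program along the sequence feasible,
      so that each minimiser is a genuine projection.\<close>
    define y' where "y' n = y (n + M)" for n
    have y': "y' \<longlonglongrightarrow> x" unfolding y'_def using y by (rule LIMSEQ_ignore_initial_segment)
    have pos: "\<gamma> (y' n) \<ge> 0" for n unfolding y'_def by (rule less_imp_le[OF M]) simp
    have "(\<lambda>n. closest_point (feasible (y' n)) (u_d (y' n))) \<longlonglongrightarrow> closest_point (feasible x) (u_d x)"
      unfolding feasible_def
    proof (rule tendsto_closest_point_halfspace[OF compact_U convex_U _ _ _ _ v0])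
      show "(\<lambda>n. drift (y' n)) \<longlonglongrightarrow> drift x" "(\<lambda>n. Lie_g g h (y' n)) \<longlonglongrightarrow> Lie_g g h x"
        "(\<lambda>n. u_d (y' n)) \<longlonglongrightarrow> u_d x"
        using cont u_d y' by (auto intro: isCont_tendsto_compose)
      show "{v \<in> U. 0 \<le> drift (y' n) + Lie_g g h (y' n) \<bullet> v} \<noteq> {}" for n
        using feasible_nonempty[OF pos] unfolding feasible_def .
    qed
    then have "(\<lambda>n. u_star (y' n)) \<longlonglongrightarrow> u_star x"
      using pos \<open>\<gamma> x > 0\<close> by (simp add: u_star_eq)
    then show "(\<lambda>n. u_star (y n)) \<longlonglongrightarrow> u_star x"
      unfolding y'_def by (rule LIMSEQ_offset)
  qed
qed

lemma blended_control_in_U: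
  assumes "u_b x \<in> U" "0 \<le> \<sigma> (\<gamma> x)" "\<sigma> (\<gamma> x) \<le> 1"
  shows "blended_control \<sigma> \<gamma> u_b u_star x \<in> U"
proof (cases "\<gamma> x \<ge> 0")
  case True
  then have "(1 - \<sigma> (\<gamma> x)) *\<^sub>R u_b x + \<sigma> (\<gamma> x) *\<^sub>R u_star x \<in> U"
    using u_star_in_U assms convex_U by (intro convexD_alt) auto
  with True show ?thesis by (simp add: blended_control_def nonneg_set_def)
qed (use assms in \<open>simp add: blended_control_def nonneg_set_def\<close>)

lemma continuous_on_blended_control:
  assumes u_d: "continuous_on UNIV u_d" and u_b: "continuous_on UNIV u_b" "\<And>x. u_b x \<in> U"
    and \<sigma>: "continuous_on UNIV \<sigma>" "\<And>a. a \<le> 0 \<Longrightarrow> \<sigma> a = 0"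
  shows "continuous_on UNIV (blended_control \<sigma> \<gamma> u_b u_star)"
proof -
  \<comment> \<open>The extension by 0 replaces the uncontrolled value of the program outside its
    domain, so that \<open>w\<close> is bounded everywhere and a single formula for the feedback
    holds on the whole space.\<close>
  define w where "w x = (if \<gamma> x \<ge> 0 then u_star x - u_b x else 0)" for x
  have eq: "blended_control \<sigma> \<gamma> u_b u_star = (\<lambda>x. u_b x + \<sigma> (\<gamma> x) *\<^sub>R w x)"
    by (auto simp: blended_control_def nonneg_set_def w_def algebra_simps)
  obtain B where B: "\<And>v. v \<in> U \<Longrightarrow> norm v \<le> B" "B > 0"
    using compact_imp_bounded[OF compact_U] by (auto simp: bounded_pos)
  have w_bound: "norm (w x) \<le> B + B" for x
    using norm_triangle_ineq4[of "u_star x" "u_b x"] B(1)[OF u_star_in_U, of x] B(1)[OF u_b(2), of x] B(2)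
    by (auto simp: w_def)
  have cont_\<gamma>: "isCont \<gamma> x" for x
    using continuous_on_gamma[of UNIV] by (simp add: continuous_on_eq_continuous_at)
  have cont_b: "isCont u_b x" for x
    using u_b(1) by (simp add: continuous_on_eq_continuous_at)
  have cont_s: "isCont (\<lambda>x. \<sigma> (\<gamma> x)) x" for x
    using \<sigma>(1) by (intro isCont_o2[OF cont_\<gamma>]) (simp add: continuous_on_eq_continuous_at)
  have "isCont (\<lambda>x. \<sigma> (\<gamma> x) *\<^sub>R w x) x" for x
  proof (cases "\<gamma> x > 0")
    case True
    have "open {y. \<gamma> y > 0}"
      by (intro open_Collect_less continuous_on_gamma continuous_on_const)
    with True have "\<forall>\<^sub>F y in nhds x. \<gamma> y > 0"
      using eventually_nhds_in_open[of "{y. \<gamma> y > 0}" x] by simp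
    then have "\<forall>\<^sub>F y in nhds x. w y = u_star y - u_b y"
      by (rule eventually_mono) (simp add: w_def)
    moreover have "isCont (\<lambda>y. u_star y - u_b y) x"
      using u_d True by (intro continuous_diff isCont_u_star cont_b)
        (auto simp: continuous_on_eq_continuous_at)
    ultimately have "isCont w x" by (simp add: isCont_cong)
    then show ?thesis by (intro continuous_intros cont_s)
  next
    case False
    then show ?thesis
      by (intro continuous_scaled_bounded[OF cont_s _ w_bound]) (simp add: \<sigma>(2))
  qed
  then show ?thesis
    unfolding eq using cont_b
    by (intro continuous_at_imp_continuous_on ballI continuous_add) auto
qed

lemma blended_control_eq_backup:
  assumes "h x \<le> \<epsilon>" "\<And>a. a \<le> 0 \<Longrightarrow> \<sigma> a = 0"
  shows "blended_control \<sigma> \<gamma> u_b u_star x = u_b x"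
proof -
  have "\<gamma> x \<le> 0" using assms(1) by (simp add: gamma_def)
  then show ?thesis using assms(2) by (simp add: blended_control_def)
qed

end

section \<open>The closed loop\<close>

text \<open>Part (a) takes continuity of \<open>u_d\<close> as an antecedent, because the minimiser
  inherits jumps of \<open>u_d\<close> where it is feasible. Parts (c) and (d) hold for every
  closed-loop solution. The bound in (d) is in extended reals: an infinite speed makes it false
  unless \<open>l_s\<close> is 0.\<close>

theorem theorem1:
  fixes f :: "real^'n \<Rightarrow> real^'n"
    and g :: "real^'n \<Rightarrow> real^'m^'n"
    and A_u :: "real^'m^'r" and b_u :: "real^'r"
    and h_s h_b :: "real^'n \<Rightarrow> real"
    and u_b u_d :: "real^'n \<Rightarrow> real^'m"
    and \<phi> :: "real^'n \<Rightarrow> real \<Rightarrow> real^'n"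
    and T :: real and N :: nat
    and \<rho> \<alpha> \<epsilon> \<kappa> :: real
    and \<sigma> :: "real \<Rightarrow> real"
  defines "U \<equiv> admissible A_u b_u"
    and "S_s \<equiv> nonneg_set h_s"
    and "S_b \<equiv> nonneg_set h_b"
    and "T_s \<equiv> T / real N"
  defines "S_star \<equiv> nonneg_set (h_star h_s h_b \<phi> T)"
    and "S_bar_star \<equiv> nonneg_set (h_bar_star h_s h_b \<phi> N T_s)"
    and "h \<equiv> softmin_barrier h_s h_b \<phi> N T_s \<rho>"
  defines "S \<equiv> nonneg_set h"
    and "\<gamma> \<equiv> gamma f g U h \<alpha> \<epsilon>"
    and "u_star \<equiv> qp_control f g U h \<alpha> \<epsilon> u_d"
  defines "u \<equiv> blended_control \<sigma> \<gamma> u_b u_star"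
    and "l_\<phi> \<equiv> max_speed (closed_loop_field f g u_b) S_bar_star"
  assumes "C1 f" and "C1 g"
    and "bounded U" and "U \<noteq> {}"
    and "C1 h_s" and "C1 h_b"
    and "S_b \<subseteq> S_s"
    and "C1 u_b" and "\<forall>x. u_b x \<in> U"
    and "forward_invariant f g u_b S_b"
    and "flow_of (closed_loop_field f g u_b) \<phi>"
    and "T > 0" and "N > 0"
    and "\<rho> > 0" and "C1 h"
    and "\<alpha> > 0"
    and "0 \<le> \<epsilon>" and "ereal \<epsilon> < (SUP x\<in>S. ereal (h x))"
    and "\<kappa> > 0"
    and "continuous_on UNIV \<sigma>" and "\<forall>a. 0 \<le> \<sigma> a \<and> \<sigma> a \<le> 1"
    and "\<forall>a\<le>0. \<sigma> a = 0" and "\<forall>a\<ge>\<kappa>. \<sigma> a = 1"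
    and "strict_mono_on {0..\<kappa>} \<sigma>"
  shows "(continuous_on UNIV u_d \<longrightarrow> continuous_on UNIV u) \<and>
    (\<forall>x. u x \<in> U) \<and>
    (S_bar_star \<subseteq> S_s \<and>
      (\<forall>x t. closed_loop_solution f g u x \<and> t \<ge> 0 \<and> x t \<in> frontier S_bar_star \<longrightarrow>
        (\<exists>\<tau>\<in>{0<..T_s}. x (t + \<tau>) \<in> S_bar_star))) \<and>
    (S_star \<subseteq> S_s \<and>
      (\<forall>x l_s. closed_loop_solution f g u x \<and> x 0 \<in> S_star \<and>
          l_s-lipschitz_on UNIV h_s \<and> ereal \<epsilon> \<ge> ereal (1/2 * T_s) * l_\<phi> * ereal l_s \<longrightarrow>
        (\<forall>t\<ge>0. x t \<in> S_star)))"
proof -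
  have "bounded (admissible A_u b_u)" using \<open>bounded U\<close> unfolding U_def .
  then have "compact U"
    unfolding U_def by (simp add: compact_eq_bounded_closed closed_admissible)
  interpret qp: barrier_qp f g U h \<alpha> \<epsilon> u_d
    using assms \<open>compact U\<close> by unfold_locales (auto simp: convex_admissible)
  define F where "F = closed_loop_field f g u_b"
  interpret semiflow F \<phi>
    using closed_loop_field_lipschitz_on_cball[OF \<open>C1 f\<close> \<open>C1 g\<close> \<open>C1 u_b\<close>]
      \<open>flow_of (closed_loop_field f g u_b) \<phi>\<close>
    by unfold_locales (auto simp: F_def)
  \<comment> \<open>Forward invariance speaks of all solutions under the backup control; a flow line
    is one of them.\<close>
  have "h_b (\<phi> x t) \<ge> 0" if "h_b x \<ge> 0" "t \<ge> 0" for x t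
  proof -
    have "closed_loop_solution f g u_b (\<phi> x)"
      using flow_has_vector_derivative unfolding closed_loop_solution_def F_def by blast
    then show ?thesis
      using \<open>forward_invariant f g u_b S_b\<close> that
      unfolding forward_invariant_def S_b_def nonneg_set_def by force
  qed
  then interpret B: backup_flow F \<phi> h_s h_b T N
    using \<open>S_b \<subseteq> S_s\<close> \<open>T > 0\<close> \<open>N > 0\<close> C1_imp_continuous_on[OF \<open>C1 h_s\<close>] C1_imp_continuous_on[OF \<open>C1 h_b\<close>]
    by unfold_locales (auto simp: S_b_def S_s_def nonneg_set_def)
  have sets: "B.T_s = T_s" "B.S_star = S_star" "B.S_bar = S_bar_star"
    by (simp_all add: B.T_s_def B.S_star_def B.S_bar_def T_s_def S_star_def S_bar_star_def)
  have h_less: "h x < v"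
    if "v \<in> set (map (\<lambda>i. h_s (\<phi> x (real i * T_s))) [0..<Suc N] @ [h_b (\<phi> x (real N * T_s))])" for x v
    unfolding h_def softmin_barrier_def
    by (rule softmin_less[OF \<open>\<rho> > 0\<close> that]) (use \<open>N > 0\<close> in simp)
  have u_eq: "u x = u_b x" if "h x \<le> \<epsilon>" for x
    unfolding u_def \<gamma>_def u_star_def using that \<open>\<forall>a\<le>0. \<sigma> a = 0\<close>
    by (intro qp.blended_control_eq_backup) auto
  have switched: "switched_backup F \<phi> h_s h_b T N h \<epsilon> (closed_loop_field f g u) x"
    if "closed_loop_solution f g u x" for x
  proof unfold_locales
    show "continuous_on UNIV h" by (rule C1_imp_continuous_on[OF \<open>C1 h\<close>])
    show "h y < h_s (\<phi> y (real i * B.T_s))" if "i \<le> N" for y i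
      unfolding sets by (rule h_less) (use that in \<open>auto simp del: upt_Suc\<close>)
    show "h y < h_b (\<phi> y T)" for y
      by (rule h_less) (simp add: B.N_T_s[unfolded sets])
    show "closed_loop_field f g u y = F y" if "h y \<le> \<epsilon>" for y
      by (simp add: F_def closed_loop_field_def u_eq[OF that])
    show "(x has_vector_derivative closed_loop_field f g u (x t)) (at t within {0..})" if "t \<ge> 0" for t
      using \<open>closed_loop_solution f g u x\<close> that unfolding closed_loop_solution_def by blast
  qed (rule \<open>0 \<le> \<epsilon>\<close>)
  have "continuous_on UNIV u" if "continuous_on UNIV u_d"
    unfolding u_def \<gamma>_def u_star_def
    using that \<open>\<forall>x. u_b x \<in> U\<close> \<open>continuous_on UNIV \<sigma>\<close> \<open>\<forall>a\<le>0. \<sigma> a = 0\<close>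
    by (intro qp.continuous_on_blended_control C1_imp_continuous_on[OF \<open>C1 u_b\<close>]) auto
  moreover have "u x \<in> U" for x
    unfolding u_def \<gamma>_def u_star_def
    using \<open>\<forall>x. u_b x \<in> U\<close> \<open>\<forall>a. 0 \<le> \<sigma> a \<and> \<sigma> a \<le> 1\<close>
    by (intro qp.blended_control_in_U) auto
  moreover have "S_bar_star \<subseteq> S_s" "S_star \<subseteq> S_s"
    using B.S_bar_safe B.S_star_safe by (auto simp: sets S_s_def nonneg_set_def)
  moreover have "\<exists>\<tau>\<in>{0<..T_s}. x (t + \<tau>) \<in> S_bar_star"
    if "closed_loop_solution f g u x" "t \<ge> 0" "x t \<in> frontier S_bar_star" for x t
  proof -
    \<comment> \<open>A boundary point of a closed set belongs to it.\<close>
    have "x t \<in> S_bar_star"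
      using that(3) frontier_subset_closed[OF B.closed_S_bar] by (auto simp: sets)
    then show ?thesis
      using switched_backup.returns_to_S_bar[OF switched[OF that(1)] that(2)] by (simp add: sets)
  qed
  moreover have "x t \<in> S_star"
    if "closed_loop_solution f g u x" "x 0 \<in> S_star" "l_s-lipschitz_on UNIV h_s"
      "ereal \<epsilon> \<ge> ereal (1/2 * T_s) * l_\<phi> * ereal l_s" "t \<ge> 0" for x l_s t
    using switched_backup.stays_in_S_star[OF switched[OF that(1)] that(3)] that(2,4,5)
    by (simp add: sets l_\<phi>_def F_def)
  ultimately show ?thesis by blast
qed

end
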